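(* There is a closed well-formed RGA term $u$ such that $\emptyset\vdash u\cdot\underline n$ is derivable in RGA for every $n\in\mathbb N$, while $\emptyset\vdash\mathcal A\cdot u$ is not derivable in RGA.
   Context: **Terms.** Raw terms are: variables $v_i$ ($i\in\mathbb N$, de Bruijn indices), and operator nodes, each consisting of an operator code, a binder count $k\in\mathbb N$ and a finite list of raw terms as arguments, in each of which the $k$ lowest indices are bound. RGA has ten operators: constants $\bot$, $\mathbf 0$, $\mathcal R$ (recursor), $\mathcal A$ (universal quantifier combinator); unary $\mathbf S$, $\neg$; unary $\lambda$ (binder count 1, the only binder); binary $=$, $\lor$, and application $\cdot$ (left associative). A term $t$ is well-formed, $\mathrm{wf}(t)$, iff it is built from variables and these ten operators at these arities and binder counts. "Term" means raw term; formulas are just terms. Closed means having no free variables. $\underline n=\mathbf S^n\mathbf 0$ is the numeral of $n$. $[v_i\mapsto s]t$ (also $[i\mapsto s]t$): capture-avoiding replacement of the free variable $v_i$ by $s$, other free variables unchanged. $b[t]$: $\beta$-instance, replacing index $0$ in $b$ by $t$ and decrementing all other free indices. $\uparrow t$: all free indices increased by one; $\uparrow\Gamma$ elementwise. $\mathrm{fv}$: set of free variables. Abbreviations: $t\neq u:=\neg(t=u)$; $t\,\mathsf N:=(t=t)$; $t\,\mathsf B:=(t\lor\neg t)$; $t\land u:=\neg(\neg t\lor\neg u)$. **Head steps** $t\triangleright t'$ (syntactic relation): $(\lambda b)\cdot t\triangleright b[t]$ if $\mathrm{wf}(t)$; $\mathcal R\cdot g\cdot h\cdot\mathbf 0\triangleright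 g$ if $\mathrm{wf}(h)$; $\mathcal R\cdot g\cdot h\cdot(\mathbf S\,\underline n)\triangleright h\cdot\underline n\cdot(\mathcal R\cdot g\cdot h\cdot\underline n)$ if $\mathrm{wf}(g)$; and $t\cdot u\triangleright t'\cdot u$ if $t\triangleright t'$. **Proofs.** A judgment $\Gamma\vdash c$ has a finite set $\Gamma$ of terms and a term $c$. A proof is a finite list of judgments each following from earlier entries by one rule below; a judgment is derivable if some proof contains it. Writing $\Gamma\vdash c$ as an assertion means derivability. Rules ($\Rightarrow$ from premises to conclusion, $\Leftrightarrow$ both directions): Structural: $\mathrm{wf}(c)\Rightarrow\Gamma,c\vdash c$; $\Gamma\vdash c\Rightarrow\Gamma,a\vdash c$; $\Gamma\vdash a$ and $\Gamma,a\vdash c\Rightarrow\Gamma\vdash c$; $\Gamma\vdash c$ with $\Gamma,c,s$ well-formed $\Rightarrow[v\mapsto s]\Gamma\vdash[v\mapsto s]c$. Truth values: $\Gamma\vdash a\Leftrightarrow\Gamma\vdash a=\underline 1$; $\Gamma\vdash\neg a\Leftrightarrow\Gamma\vdash a=\underline 0$. Negation: $\Gamma\vdash\neg a$, $\Gamma\vdash a$, $\mathrm{wf}(c)\Rightarrow\Gamma\vdash c$; $\Gamma\vdash a\Leftrightarrow\Gamma\vdash\neg\neg a$. Disjunction: $\Gamma\vdash a$, $\mathrm{wf}(b)\Rightarrow\Gamma\vdash a\lor b$; $\Gamma\vdash b$, $\mathrm{wf}(a)\Rightarrow\Gamma\vdash a\lor b$; $\Gamma\vdash\neg a$, $\Gamma\vdash\neg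 b\Rightarrow\Gamma\vdash\neg(a\lor b)$; $\Gamma\vdash a\lor b$, $\Gamma,a\vdash c$, $\Gamma,b\vdash c\Rightarrow\Gamma\vdash c$; $\Gamma\vdash\neg(a\lor b)\Rightarrow\Gamma\vdash\neg a$, and $\Rightarrow\Gamma\vdash\neg b$. Equality: $\Gamma\vdash a\,\mathsf N\Leftrightarrow\Gamma\vdash a=a$; $\Gamma\vdash a=b\Rightarrow\Gamma\vdash b=a$; $\Gamma\vdash a=b$, $\Gamma\vdash[v\mapsto a]p$, $\mathrm{wf}(p)\Rightarrow\Gamma\vdash[v\mapsto b]p$; $\Gamma\vdash a\ne b\Rightarrow\Gamma\vdash b\ne a$; $\Gamma\vdash a\,\mathsf N$, $\Gamma\vdash b\,\mathsf N\Rightarrow\Gamma\vdash(a=b)\,\mathsf B$; $\Gamma\vdash(a=b)\,\mathsf B\Rightarrow\Gamma\vdash(a\,\mathsf N)\land(b\,\mathsf N)$. Naturals: $\Gamma\vdash\mathbf 0\,\mathsf N$; $\Gamma\vdash a\,\mathsf N\Leftrightarrow\Gamma\vdash\mathbf S a\,\mathsf N$; $\Gamma\vdash a\,\mathsf N\Rightarrow\Gamma\vdash\mathbf S a\ne\mathbf 0$; $\Gamma\vdash a\ne b\Leftrightarrow\Gamma\vdash\mathbf S a\ne\mathbf S b$; $\Gamma\vdash\mathbf S a=\mathbf S b\Rightarrow\Gamma\vdash a=b$; $\Gamma\vdash\bot\,\mathsf N$, $\mathrm{wf}(p)\Rightarrow\Gamma\vdash p$. Induction: $\Gamma\vdash[i\mapsto\mathbf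 0]c$; $v_i\,\mathsf N,c,\Gamma\vdash[i\mapsto\mathbf S v_i]c$; $\Gamma\vdash a\,\mathsf N$; $\mathrm{wf}(c)$; $i\notin\mathrm{fv}(\Gamma)$ $\Rightarrow\Gamma\vdash[i\mapsto a]c$. Conversion: if $c\triangleright c'$: $\Gamma\vdash c'\Leftrightarrow\Gamma\vdash c$; $\Gamma\vdash c'\,\mathsf N\Rightarrow\Gamma\vdash c=c'$. Recursor: $\Gamma\vdash m\,\mathsf N$, $\Gamma\vdash(h\cdot m\cdot(\mathcal R\cdot g\cdot h\cdot m))\,\mathsf N$, $\mathrm{wf}(g)\Rightarrow\Gamma\vdash\mathcal R\cdot g\cdot h\cdot(\mathbf S m)=h\cdot m\cdot(\mathcal R\cdot g\cdot h\cdot m)$. Quantifier: $v_0\,\mathsf N,\uparrow\Gamma\vdash\uparrow f\cdot v_0\Rightarrow\Gamma\vdash\mathcal A\cdot f$; $\Gamma\vdash\mathcal A\cdot f$, $\Gamma\vdash a\,\mathsf N\Rightarrow\Gamma\vdash f\cdot a$; $\Gamma\vdash\neg(f\cdot a)$, $\Gamma\vdash a\,\mathsf N\Rightarrow\Gamma\vdash\neg(\mathcal A\cdot f)$; $\Gamma\vdash\neg(\mathcal A\cdot f)$ and $v_0\,\mathsf N,\neg(\uparrow f\cdot v_0),\uparrow\Gamma\vdash\uparrow c\Rightarrow\Gamma\vdash c$. *)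

theory Defs
  imports Main "HOL-Library.FSet"
begin

section \<open>Raw terms\<close>

text \<open>
  The ten operators of RGA, together with codes for foreign operators. The latter occur in raw
  terms only, never in well-formed ones.
\<close>

datatype opcode =
    OBot | OZero | ORec | OAll | OSuc | ONeg | OLam | OEq | OOr | OApp | OForeign nat

text \<open>
  In a node \<open>Op f k ts\<close> the \<open>k\<close> lowest indices are bound in each of the arguments \<open>ts\<close>;
  neither \<open>k\<close> nor the number of arguments is tied to \<open>f\<close> at this level.
\<close>

datatype tm = Var nat | Op opcode nat "tm list"

text \<open>Binder count and number of arguments of each operator.\<close>

fun op_sig :: "opcode \<Rightarrow> (nat \<times> nat) option" where
  "op_sig OBot = Some (0, 0)"
| "op_sig OZero = Some (0, 0)"
| "op_sig ORec = Some (0, 0)"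
| "op_sig OAll = Some (0, 0)"
| "op_sig OSuc = Some (0, 1)"
| "op_sig ONeg = Some (0, 1)"
| "op_sig OLam = Some (1, 1)"
| "op_sig OEq = Some (0, 2)"
| "op_sig OOr = Some (0, 2)"
| "op_sig OApp = Some (0, 2)"
| "op_sig (OForeign _) = None"

fun wf_tm :: "tm \<Rightarrow> bool" where
  "wf_tm (Var i) \<longleftrightarrow> True"
| "wf_tm (Op f k ts) \<longleftrightarrow> op_sig f = Some (k, length ts) \<and> (\<forall>t \<in> set ts. wf_tm t)"

abbreviation BOT :: tm where "BOT \<equiv> Op OBot 0 []"
abbreviation ZERO :: tm where "ZERO \<equiv> Op OZero 0 []"
abbreviation REC :: tm where "REC \<equiv> Op ORec 0 []"
abbreviation FORALL :: tm where "FORALL \<equiv> Op OAll 0 []"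
abbreviation SUC :: "tm \<Rightarrow> tm" where "SUC t \<equiv> Op OSuc 0 [t]"
abbreviation NEG :: "tm \<Rightarrow> tm" where "NEG t \<equiv> Op ONeg 0 [t]"
abbreviation LAM :: "tm \<Rightarrow> tm" where "LAM t \<equiv> Op OLam 1 [t]"
abbreviation EQ :: "tm \<Rightarrow> tm \<Rightarrow> tm" (infix "\<^bold>=" 60) where "t \<^bold>= u \<equiv> Op OEq 0 [t, u]"
abbreviation OR :: "tm \<Rightarrow> tm \<Rightarrow> tm" (infixr "\<^bold>\<or>" 55) where "t \<^bold>\<or> u \<equiv> Op OOr 0 [t, u]"
abbreviation APP :: "tm \<Rightarrow> tm \<Rightarrow> tm" (infixl "\<bullet>" 75) where "t \<bullet> u \<equiv> Op OApp 0 [t, u]"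

abbreviation NEQ :: "tm \<Rightarrow> tm \<Rightarrow> tm" (infix "\<^bold>\<noteq>" 60) where "t \<^bold>\<noteq> u \<equiv> NEG (t \<^bold>= u)"
abbreviation AND :: "tm \<Rightarrow> tm \<Rightarrow> tm" (infixr "\<^bold>\<and>" 57) where "t \<^bold>\<and> u \<equiv> NEG (NEG t \<^bold>\<or> NEG u)"

text \<open>Read: \<open>t\<close> denotes a natural number; \<open>t\<close> denotes a truth value.\<close>

abbreviation isN :: "tm \<Rightarrow> tm" where "isN t \<equiv> (t \<^bold>= t)"
abbreviation isB :: "tm \<Rightarrow> tm" where "isB t \<equiv> (t \<^bold>\<or> NEG t)"

fun num :: "nat \<Rightarrow> tm" where
  "num 0 = ZERO"
| "num (Suc n) = SUC (num n)"

fun fv :: "tm \<Rightarrow> nat set" where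
  "fv (Var i) = {i}"
| "fv (Op f k ts) = {i. \<exists>t \<in> set ts. i + k \<in> fv t}"

definition closed_tm :: "tm \<Rightarrow> bool" where
  "closed_tm t \<longleftrightarrow> fv t = {}"

text \<open>\<open>shift d c t\<close> increases by \<open>d\<close> all free indices of \<open>t\<close> that are at least \<open>c\<close>.\<close>

fun shift :: "nat \<Rightarrow> nat \<Rightarrow> tm \<Rightarrow> tm" where
  "shift d c (Var i) = Var (if i < c then i else i + d)"
| "shift d c (Op f k ts) = Op f k (map (shift d (c + k)) ts)"

abbreviation up :: "tm \<Rightarrow> tm" where
  "up t \<equiv> shift 1 0 t"

text \<open>\<open>subst i s t\<close> replaces the free variable \<open>i\<close> and leaves the other free variables unchanged.\<close>

fun subst :: "nat \<Rightarrow> tm \<Rightarrow> tm \<Rightarrow> tm" where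
  "subst i s (Var j) = (if j = i then s else Var j)"
| "subst i s (Op f k ts) = Op f k (map (subst (i + k) (shift k 0 s)) ts)"

text \<open>
  \<open>inst_at c s t\<close> replaces index \<open>c\<close> of \<open>t\<close> by \<open>s\<close> and decrements all larger free indices;
  here \<open>c\<close> counts the binders passed so far. It differs from \<open>subst\<close> in the decrementing.
\<close>

fun inst_at :: "nat \<Rightarrow> tm \<Rightarrow> tm \<Rightarrow> tm" where
  "inst_at c s (Var j) =
    (if j < c then Var j else if j = c then shift c 0 s else Var (j - 1))"
| "inst_at c s (Op f k ts) = Op f k (map (inst_at (c + k) s) ts)"

abbreviation beta_inst :: "tm \<Rightarrow> tm \<Rightarrow> tm" where
  "beta_inst b t \<equiv> inst_at 0 t b"


section \<open>Head steps\<close>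

inductive head_step :: "tm \<Rightarrow> tm \<Rightarrow> bool" (infix "\<triangleright>" 50) where
  beta: "wf_tm t \<Longrightarrow> LAM b \<bullet> t \<triangleright> beta_inst b t"
| rec_zero: "wf_tm h \<Longrightarrow> REC \<bullet> g \<bullet> h \<bullet> ZERO \<triangleright> g"
| rec_suc: "wf_tm g \<Longrightarrow>
    REC \<bullet> g \<bullet> h \<bullet> SUC (num n) \<triangleright> h \<bullet> num n \<bullet> (REC \<bullet> g \<bullet> h \<bullet> num n)"
| app: "t \<triangleright> t' \<Longrightarrow> t \<bullet> u \<triangleright> t' \<bullet> u"


section \<open>Proofs\<close>

datatype sequent = Sequent "tm fset" tm (infix "\<turnstile>" 40)

abbreviation wf_ctx :: "tm fset \<Rightarrow> bool" where
  "wf_ctx \<Gamma> \<equiv> \<forall>a \<in> fset \<Gamma>. wf_tm a"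

abbreviation fv_ctx :: "tm fset \<Rightarrow> nat set" where
  "fv_ctx \<Gamma> \<equiv> \<Union>a \<in> fset \<Gamma>. fv a"

text \<open>
  \<open>rga_rule Js J\<close>: the sequent \<open>J\<close> is the conclusion of an instance of a rule with premises \<open>Js\<close>.
  Metavariables range over all raw terms; well-formedness is required only where a rule says so.
\<close>

inductive rga_rule :: "sequent list \<Rightarrow> sequent \<Rightarrow> bool" where
  \<comment> \<open>structural rules\<close>
  hyp: "wf_tm c \<Longrightarrow> rga_rule [] (finsert c \<Gamma> \<turnstile> c)"
| weaken: "rga_rule [\<Gamma> \<turnstile> c] (finsert a \<Gamma> \<turnstile> c)"
| cut: "rga_rule [\<Gamma> \<turnstile> a, finsert a \<Gamma> \<turnstile> c] (\<Gamma> \<turnstile> c)"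
| substitution: "wf_ctx \<Gamma> \<Longrightarrow> wf_tm c \<Longrightarrow> wf_tm s \<Longrightarrow>
    rga_rule [\<Gamma> \<turnstile> c] (subst v s |`| \<Gamma> \<turnstile> subst v s c)"
  \<comment> \<open>truth values\<close>
| true_intro: "rga_rule [\<Gamma> \<turnstile> a] (\<Gamma> \<turnstile> a \<^bold>= num 1)"
| true_elim: "rga_rule [\<Gamma> \<turnstile> a \<^bold>= num 1] (\<Gamma> \<turnstile> a)"
| false_intro: "rga_rule [\<Gamma> \<turnstile> NEG a] (\<Gamma> \<turnstile> a \<^bold>= num 0)"
| false_elim: "rga_rule [\<Gamma> \<turnstile> a \<^bold>= num 0] (\<Gamma> \<turnstile> NEG a)"
  \<comment> \<open>negation\<close>
| explosion: "wf_tm c \<Longrightarrow> rga_rule [\<Gamma> \<turnstile> NEG a, \<Gamma> \<turnstile> a] (\<Gamma> \<turnstile> c)"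
| dneg_intro: "rga_rule [\<Gamma> \<turnstile> a] (\<Gamma> \<turnstile> NEG (NEG a))"
| dneg_elim: "rga_rule [\<Gamma> \<turnstile> NEG (NEG a)] (\<Gamma> \<turnstile> a)"
  \<comment> \<open>disjunction\<close>
| or_intro1: "wf_tm b \<Longrightarrow> rga_rule [\<Gamma> \<turnstile> a] (\<Gamma> \<turnstile> a \<^bold>\<or> b)"
| or_intro2: "wf_tm a \<Longrightarrow> rga_rule [\<Gamma> \<turnstile> b] (\<Gamma> \<turnstile> a \<^bold>\<or> b)"
| nor_intro: "rga_rule [\<Gamma> \<turnstile> NEG a, \<Gamma> \<turnstile> NEG b] (\<Gamma> \<turnstile> NEG (a \<^bold>\<or> b))"
| or_elim: "rga_rule [\<Gamma> \<turnstile> a \<^bold>\<or> b, finsert a \<Gamma> \<turnstile> c, finsert b \<Gamma> \<turnstile> c] (\<Gamma> \<turnstile> c)"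
| nor_elim1: "rga_rule [\<Gamma> \<turnstile> NEG (a \<^bold>\<or> b)] (\<Gamma> \<turnstile> NEG a)"
| nor_elim2: "rga_rule [\<Gamma> \<turnstile> NEG (a \<^bold>\<or> b)] (\<Gamma> \<turnstile> NEG b)"
  \<comment> \<open>equality; as \<open>isN a\<close> abbreviates \<open>a \<^bold>= a\<close>, the first two rules are trivial\<close>
| nat_eq: "rga_rule [\<Gamma> \<turnstile> isN a] (\<Gamma> \<turnstile> a \<^bold>= a)"
| eq_nat: "rga_rule [\<Gamma> \<turnstile> a \<^bold>= a] (\<Gamma> \<turnstile> isN a)"
| eq_sym: "rga_rule [\<Gamma> \<turnstile> a \<^bold>= b] (\<Gamma> \<turnstile> b \<^bold>= a)"
| eq_subst: "wf_tm p \<Longrightarrow> rga_rule [\<Gamma> \<turnstile> a \<^bold>= b, \<Gamma> \<turnstile> subst v a p] (\<Gamma> \<turnstile> subst v b p)"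
| neq_sym: "rga_rule [\<Gamma> \<turnstile> a \<^bold>\<noteq> b] (\<Gamma> \<turnstile> b \<^bold>\<noteq> a)"
| eq_bool: "rga_rule [\<Gamma> \<turnstile> isN a, \<Gamma> \<turnstile> isN b] (\<Gamma> \<turnstile> isB (a \<^bold>= b))"
| eq_bool_elim: "rga_rule [\<Gamma> \<turnstile> isB (a \<^bold>= b)] (\<Gamma> \<turnstile> isN a \<^bold>\<and> isN b)"
  \<comment> \<open>natural numbers\<close>
| zero_nat: "rga_rule [] (\<Gamma> \<turnstile> isN ZERO)"
| suc_nat: "rga_rule [\<Gamma> \<turnstile> isN a] (\<Gamma> \<turnstile> isN (SUC a))"
| suc_nat_elim: "rga_rule [\<Gamma> \<turnstile> isN (SUC a)] (\<Gamma> \<turnstile> isN a)"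
| suc_neq_zero: "rga_rule [\<Gamma> \<turnstile> isN a] (\<Gamma> \<turnstile> SUC a \<^bold>\<noteq> ZERO)"
| suc_neq: "rga_rule [\<Gamma> \<turnstile> a \<^bold>\<noteq> b] (\<Gamma> \<turnstile> SUC a \<^bold>\<noteq> SUC b)"
| suc_neq_elim: "rga_rule [\<Gamma> \<turnstile> SUC a \<^bold>\<noteq> SUC b] (\<Gamma> \<turnstile> a \<^bold>\<noteq> b)"
| suc_inj: "rga_rule [\<Gamma> \<turnstile> SUC a \<^bold>= SUC b] (\<Gamma> \<turnstile> a \<^bold>= b)"
| bot_nat: "wf_tm p \<Longrightarrow> rga_rule [\<Gamma> \<turnstile> isN BOT] (\<Gamma> \<turnstile> p)"
  \<comment> \<open>induction\<close>
| nat_induction: "wf_tm c \<Longrightarrow> i \<notin> fv_ctx \<Gamma> \<Longrightarrow>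
    rga_rule
      [\<Gamma> \<turnstile> subst i ZERO c,
       finsert (isN (Var i)) (finsert c \<Gamma>) \<turnstile> subst i (SUC (Var i)) c,
       \<Gamma> \<turnstile> isN a]
      (\<Gamma> \<turnstile> subst i a c)"
  \<comment> \<open>conversion\<close>
| conv_expand: "c \<triangleright> c' \<Longrightarrow> rga_rule [\<Gamma> \<turnstile> c'] (\<Gamma> \<turnstile> c)"
| conv_reduce: "c \<triangleright> c' \<Longrightarrow> rga_rule [\<Gamma> \<turnstile> c] (\<Gamma> \<turnstile> c')"
| conv_eq: "c \<triangleright> c' \<Longrightarrow> rga_rule [\<Gamma> \<turnstile> isN c'] (\<Gamma> \<turnstile> c \<^bold>= c')"
  \<comment> \<open>recursor\<close>
| recursor: "wf_tm g \<Longrightarrow>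
    rga_rule
      [\<Gamma> \<turnstile> isN m, \<Gamma> \<turnstile> isN (h \<bullet> m \<bullet> (REC \<bullet> g \<bullet> h \<bullet> m))]
      (\<Gamma> \<turnstile> REC \<bullet> g \<bullet> h \<bullet> SUC m \<^bold>= h \<bullet> m \<bullet> (REC \<bullet> g \<bullet> h \<bullet> m))"
  \<comment> \<open>quantifier\<close>
| all_intro:
    "rga_rule [finsert (isN (Var 0)) (up |`| \<Gamma>) \<turnstile> up f \<bullet> Var 0] (\<Gamma> \<turnstile> FORALL \<bullet> f)"
| all_elim: "rga_rule [\<Gamma> \<turnstile> FORALL \<bullet> f, \<Gamma> \<turnstile> isN a] (\<Gamma> \<turnstile> f \<bullet> a)"
| nall_intro: "rga_rule [\<Gamma> \<turnstile> NEG (f \<bullet> a), \<Gamma> \<turnstile> isN a] (\<Gamma> \<turnstile> NEG (FORALL \<bullet> f))"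
| nall_elim:
    "rga_rule
      [\<Gamma> \<turnstile> NEG (FORALL \<bullet> f),
       finsert (isN (Var 0)) (finsert (NEG (up f \<bullet> Var 0)) (up |`| \<Gamma>)) \<turnstile> up c]
      (\<Gamma> \<turnstile> c)"

definition is_proof :: "sequent list \<Rightarrow> bool" where
  "is_proof P \<longleftrightarrow>
    (\<forall>i < length P. \<exists>Js. set Js \<subseteq> set (take i P) \<and> rga_rule Js (P ! i))"

definition derivable :: "sequent \<Rightarrow> bool" where
  "derivable J \<longleftrightarrow> (\<exists>P. is_proof P \<and> J \<in> set P)"

end

theory Submission
  imports Defs
begin

text \<open>
  This is Goedel's first incompleteness theorem for RGA, in the form of an
  \<open>\<omega>\<close>-incompleteness. Two ingredients are needed: RGA is consistent, and RGA can decide by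
  computation whether a given sequent shows up within \<open>n\<close> rounds of an enumeration of all derivable
  sequents. Let \<open>q\<close> be a term for which \<open>q \<cdot> x \<cdot> n\<close> reduces to the false equation \<open>0 = 1\<close> if
  \<open>\<A> \<cdot> (y \<cdot> x)\<close> shows up within \<open>n\<close> rounds, where \<open>y\<close> is the term that \<open>x\<close> encodes, and to
  \<open>0 = 0\<close> otherwise. For \<open>u = q \<cdot> x\<close>, where \<open>x\<close> encodes \<open>q\<close> itself, \<open>u \<cdot> n\<close> then says that
  \<open>\<A> \<cdot> u\<close> has not been derived within \<open>n\<close> rounds. If \<open>\<A> \<cdot> u\<close> were derivable, then some
  \<open>u \<cdot> n\<close> would reduce to \<open>0 = 1\<close>, although it follows from \<open>\<A> \<cdot> u\<close>; this contradicts
  consistency. So \<open>\<A> \<cdot> u\<close> is not derivable, every \<open>u \<cdot> n\<close> reduces to \<open>0 = 0\<close>, and the conversion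
  rule makes every \<open>u \<cdot> n\<close> derivable.

  Consistency comes from a standard model, given as an inductive evaluation \<open>evals t n\<close> of closed terms
  with an infinitary clause for the quantifier. Terms without a value are harmless because a sequent is
  read as: whenever all hypotheses evaluate to \<open>1\<close>, so does the conclusion. The delicate rule is the
  replacement of equals. In a term, a subterm may be exchanged for one with the same value, even in
  function position, because a term that has a number as value cannot be applied usefully
  (\<open>dead_app_no_eval\<close>, \<open>sim_step_evals\<close>).

  For the second ingredient no arithmetization is used. The conversion rules make RGA a call-by-name
  \<open>\<lambda>\<close>-calculus on closed formulas, so data can be encoded by closed \<open>\<lambda>\<close>-terms: each datum is
  represented by its own recursor. A logical relation \<open>rep x t\<close>, indexed by the type of \<open>x\<close>, says
  that \<open>t\<close> represents \<open>x\<close>; at function types it says that representations are mapped to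
  representations. Elements that have a representation are called \<open>computable\<close>. They are closed under the
  usual ways of defining functions, so that the computability of the syntactic operations, of the rules
  and finally of the enumeration (\<open>computable_theorems\<close>) is read off from their definitions. The numeral
  argument of \<open>u\<close> is turned into a represented number by the recursor of RGA (\<open>rep_decode\<close>).
\<close>

section \<open>Closing substitutions\<close>

text \<open>
  Simultaneous substitution of the terms \<open>\<sigma>\<close> for the free variables, below \<open>c\<close> binders. It is used for
  closed \<open>\<sigma>\<close> only, which is why the substituted terms are not shifted.
\<close>

fun csub :: "nat \<Rightarrow> (nat \<Rightarrow> tm) \<Rightarrow> tm \<Rightarrow> tm" where
  "csub c \<sigma> (Var j) = (if j < c then Var j else \<sigma> (j - c))"
| "csub c \<sigma> (Op f k ts) = Op f k (map (csub (c + k) \<sigma>) ts)"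

lemma fv_argument_bound:
  assumes "t \<in> set ts" "\<forall>i \<in> fv (Op f k ts). i < c"
  shows "\<forall>i \<in> fv t. i < c + k"
proof
  fix i assume i: "i \<in> fv t"
  show "i < c + k"
  proof (cases "i < k")
    case False
    then have "i - k \<in> fv (Op f k ts)" using i assms(1) by (auto intro!: bexI[of _ t])
    then show ?thesis using assms(2) by fastforce
  qed simp
qed

lemma shift_bounded: "\<forall>i \<in> fv t. i < c \<Longrightarrow> shift d c t = t"
proof (induction t arbitrary: c)
  case (Op f k ts)
  then show ?case using fv_argument_bound[OF _ Op.prems] by (simp add: map_idI)
qed simp

lemma inst_at_bounded: "\<forall>i \<in> fv t. i < c \<Longrightarrow> inst_at c s t = t"
proof (induction t arbitrary: c)
  case (Op f k ts)
  then show ?case using fv_argument_bound[OF _ Op.prems] by (simp add: map_idI)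
qed simp

lemma csub_bounded: "\<forall>i \<in> fv t. i < c \<Longrightarrow> csub c \<sigma> t = t"
proof (induction t arbitrary: c)
  case (Op f k ts)
  then show ?case using fv_argument_bound[OF _ Op.prems] by (simp add: map_idI)
qed simp

lemma shift_closed [simp]: "closed_tm t \<Longrightarrow> shift d c t = t"
  by (simp add: closed_tm_def shift_bounded)

lemma inst_at_closed [simp]: "closed_tm t \<Longrightarrow> inst_at c s t = t"
  by (simp add: closed_tm_def inst_at_bounded)

lemma csub_closed [simp]: "closed_tm t \<Longrightarrow> csub c \<sigma> t = t"
  by (simp add: closed_tm_def csub_bounded)

lemma closed_num [simp]: "closed_tm (num n)"
  unfolding closed_tm_def by (induction n) auto

lemma shift_shift: "shift k e (shift c e t) = shift (c + k) e t"
  by (induction c e t rule: shift.induct) auto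

lemma fv_csub: "\<forall>i. closed_tm (\<sigma> i) \<Longrightarrow> i \<in> fv (csub c \<sigma> t) \<Longrightarrow> i < c"
  by (induction c \<sigma> t arbitrary: i rule: csub.induct) (force simp: closed_tm_def split: if_splits)+

lemma csub_is_closed [simp]: "\<forall>i. closed_tm (\<sigma> i) \<Longrightarrow> closed_tm (csub 0 \<sigma> t)"
  using fv_csub unfolding closed_tm_def by blast

lemma csub_shift: "csub (e + c) \<sigma> (shift c e t) = csub e \<sigma> t"
  by (induction c e t rule: shift.induct) (auto simp: add.assoc add.commute add.left_commute)

lemma csub_subst:
  "csub c \<sigma> (subst (c + v) (shift c 0 s) t) = csub c (\<sigma>(v := csub 0 \<sigma> s)) t"
proof (induction t arbitrary: c)
  case (Var j)
  then show ?case using csub_shift[of 0 c \<sigma> s] by auto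
next
  case (Op f k ts)
  then show ?case
    by (simp add: shift_shift) (metis add.assoc add.commute)
qed

lemma shift_0 [simp]: "shift 0 c t = t"
  by (induction t arbitrary: c) (auto simp: map_idI)

lemma csub_subst0: "csub 0 \<sigma> (subst v s t) = csub 0 (\<sigma>(v := csub 0 \<sigma> s)) t"
  using csub_subst[of 0 \<sigma> v s t] by simp

text \<open>
  An additional hypothesis variable in front is invisible to terms that were shifted past it. This is
  what the quantifier rules need.
\<close>

lemma csub_up: "csub c (case_nat x \<sigma>) (shift 1 c t) = csub c \<sigma> t"
proof (induction t arbitrary: c)
  case (Var j)
  then show ?case by (auto simp: Suc_diff_le)
qed auto

lemma csub_inst_at:
  assumes "\<forall>i. closed_tm (\<sigma> i)"
  shows "csub c \<sigma> (inst_at c s b) = inst_at c (csub 0 \<sigma> s) (csub (Suc c) \<sigma> b)"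
proof (induction b arbitrary: c)
  case (Var j)
  then show ?case using csub_shift[of 0 c \<sigma> s] assms by auto
qed auto

lemma csub_fresh:
  "(\<And>i. c + i \<in> fv t \<Longrightarrow> \<sigma> i = \<tau> i) \<Longrightarrow> csub c \<sigma> t = csub c \<tau> t"
proof (induction t arbitrary: c)
  case (Op f k ts)
  have "csub (c + k) \<sigma> t = csub (c + k) \<tau> t" if "t \<in> set ts" for t
    by (rule Op.IH[OF that]) (use Op.prems that in \<open>auto simp: add.assoc add.commute add.left_commute\<close>)
  then show ?case by simp
qed (auto simp: not_less)

section \<open>Evaluation of closed terms\<close>

text \<open>
  The standard model. The value of a formula is its truth value \<open>0\<close> or \<open>1\<close>, and many terms have no
  value. \<open>step\<close> extends the head steps of RGA in that the last argument of the recursor only has to evaluate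
  to a numeral instead of being one; otherwise a function-valued recursion would distinguish arguments that RGA
  can prove equal.
\<close>

inductive step :: "tm \<Rightarrow> tm \<Rightarrow> bool" and evals :: "tm \<Rightarrow> nat \<Rightarrow> bool" where
  step_beta: "step (LAM b \<bullet> t) (beta_inst b t)"
| step_rec_zero: "evals m 0 \<Longrightarrow> step (REC \<bullet> g \<bullet> h \<bullet> m) g"
| step_rec_suc: "evals m (Suc k) \<Longrightarrow>
    step (REC \<bullet> g \<bullet> h \<bullet> m) (h \<bullet> num k \<bullet> (REC \<bullet> g \<bullet> h \<bullet> num k))"
| step_app: "step t t' \<Longrightarrow> step (t \<bullet> u) (t' \<bullet> u)"
| evals_zero: "evals ZERO 0"
| evals_suc: "evals t n \<Longrightarrow> evals (SUC t) (Suc n)"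
| evals_neg1: "evals t 0 \<Longrightarrow> evals (NEG t) (Suc 0)"
| evals_neg0: "evals t (Suc 0) \<Longrightarrow> evals (NEG t) 0"
| evals_or1: "evals t (Suc 0) \<Longrightarrow> evals (t \<^bold>\<or> u) (Suc 0)"
| evals_or2: "evals u (Suc 0) \<Longrightarrow> evals (t \<^bold>\<or> u) (Suc 0)"
| evals_or0: "evals t 0 \<Longrightarrow> evals u 0 \<Longrightarrow> evals (t \<^bold>\<or> u) 0"
| evals_eq1: "evals t n \<Longrightarrow> evals u n \<Longrightarrow> evals (t \<^bold>= u) (Suc 0)"
| evals_eq0: "evals t n \<Longrightarrow> evals u m \<Longrightarrow> n \<noteq> m \<Longrightarrow> evals (t \<^bold>= u) 0"
| evals_all1: "(\<And>n. evals (f \<bullet> num n) (Suc 0)) \<Longrightarrow> evals (FORALL \<bullet> f) (Suc 0)"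
| evals_all0: "evals (f \<bullet> num n) 0 \<Longrightarrow> evals (FORALL \<bullet> f) 0"
| evals_step: "step t t' \<Longrightarrow> evals t' n \<Longrightarrow> evals t n"

inductive_cases step_appE: "step (t \<bullet> u) s"
inductive_cases step_opE: "step (Op f k ts) s"
inductive_cases evals_opE: "evals (Op f k ts) n"
inductive_cases evals_negE: "evals (NEG t) n"
inductive_cases evals_sucE: "evals (SUC t) n"
inductive_cases evals_orE: "evals (t \<^bold>\<or> u) n"
inductive_cases evals_eqE: "evals (t \<^bold>= u) n"

lemma step_source: "step t s \<Longrightarrow> \<exists>t1 u. t = t1 \<bullet> u"
  by (erule step.cases) blast+

lemma step_not_app: "f \<noteq> OApp \<Longrightarrow> \<not> step (Op f k ts) s"
  by (auto elim: step_opE)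

lemma no_eval [simp]:
  "\<not> evals BOT n" "\<not> evals REC n" "\<not> evals FORALL n" "\<not> evals (Op OLam k [b]) n"
  by (auto elim: evals_opE simp: step_not_app)

lemma evals_num: "evals (num n) n"
  by (induction n) (auto intro: evals_zero evals_suc)

lemma evals_sucD: "evals (SUC t) n \<Longrightarrow> \<exists>m. n = Suc m \<and> evals t m"
  by (erule evals_sucE) (auto simp: step_not_app)

lemma evals_negD: "evals (NEG t) n \<Longrightarrow> n = 0 \<and> evals t (Suc 0) \<or> n = Suc 0 \<and> evals t 0"
  by (erule evals_negE) (auto simp: step_not_app)

lemma evals_orD: "evals (t \<^bold>\<or> u) n \<Longrightarrow>
    n = Suc 0 \<and> (evals t (Suc 0) \<or> evals u (Suc 0)) \<or> n = 0 \<and> evals t 0 \<and> evals u 0"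
  by (erule evals_orE) (auto simp: step_not_app)

lemma evals_eqD: "evals (t \<^bold>= u) n \<Longrightarrow> \<exists>i j. evals t i \<and> evals u j \<and> n = (if i = j then Suc 0 else 0)"
  by (erule evals_eqE) (auto simp: step_not_app)

lemma step_FORALL: "\<not> step (FORALL \<bullet> f) s"
  by (auto elim!: step_appE simp: step_not_app)

lemma step_REC: "\<not> step (REC \<bullet> g) s" "\<not> step (REC \<bullet> g \<bullet> h) s"
  by (auto elim!: step_appE simp: step_not_app)

lemma evals_FORALL: "evals (FORALL \<bullet> f) n \<Longrightarrow>
    n = Suc 0 \<and> (\<forall>i. evals (f \<bullet> num i) (Suc 0)) \<or> n = 0 \<and> (\<exists>i. evals (f \<bullet> num i) 0)"
  by (erule evals_opE) (auto simp: step_FORALL)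

text \<open>
  A term that can make a step is an application not headed by the quantifier, so its value can only come
  from a step.
\<close>

lemma evals_reducible: "evals t n \<Longrightarrow> step t s \<Longrightarrow> \<exists>s'. step t s' \<and> evals s' n"
  by (erule evals.cases) (auto simp: step_FORALL step_not_app)

lemma no_eval_REC [simp]: "\<not> evals (REC \<bullet> g) n" "\<not> evals (REC \<bullet> g \<bullet> h) n"
  by (auto elim: evals_opE simp: step_REC)

lemma step_evals_deterministic:
  "step t s \<Longrightarrow> (\<forall>s'. step t s' \<longrightarrow> s' = s)"
  "evals t n \<Longrightarrow> (\<forall>m. evals t m \<longrightarrow> m = n)"
proof (induction rule: step_evals.inducts)
  case (step_beta b t)
  then show ?case by (auto elim!: step_appE simp: step_not_app)
next
  case (step_rec_zero m g h)
  then show ?case by (auto elim!: step_appE[of "REC \<bullet> g \<bullet> h"] simp: step_REC)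
next
  case (step_rec_suc m k g h)
  then show ?case by (auto elim!: step_appE[of "REC \<bullet> g \<bullet> h"] simp: step_REC)
next
  case (step_app t t' u)
  show ?case
  proof (intro allI impI)
    fix s' assume "step (t \<bullet> u) s'"
    then show "s' = t' \<bullet> u"
      by (rule step_appE) (use step_app in \<open>auto simp: step_REC step_not_app\<close>)
  qed
next
  case evals_zero
  then show ?case by (auto elim: evals_opE simp: step_not_app)
next
  case (evals_step t t' n)
  show ?case
  proof (intro allI impI)
    fix m assume "evals t m"
    then obtain s where "step t s" "evals s m"
      using evals_reducible evals_step by blast
    then show "m = n" using evals_step by blast
  qed
next
  case (evals_suc t n)
  then show ?case using evals_sucD by blast
next
  case (evals_neg1 t)
  then show ?case by (metis evals_negD nat.distinct(1))
next
  case (evals_neg0 t)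
  then show ?case by (metis evals_negD nat.distinct(1))
next
  case (evals_or1 t u)
  then show ?case by (metis evals_orD nat.distinct(1))
next
  case (evals_or2 u t)
  then show ?case by (metis evals_orD nat.distinct(1))
next
  case (evals_or0 t u)
  then show ?case by (metis evals_orD nat.distinct(1))
next
  case (evals_eq1 t n u)
  then show ?case by (metis evals_eqD)
next
  case (evals_eq0 t n u m)
  then show ?case by (metis evals_eqD)
next
  case (evals_all1 f)
  then show ?case by (metis evals_FORALL nat.distinct(1))
next
  case (evals_all0 f i)
  then show ?case by (metis evals_FORALL nat.distinct(1))
qed

lemmas step_unique = step_evals_deterministic(1)[rule_format]
lemmas evals_unique = step_evals_deterministic(2)[rule_format]

lemma evals_forward: "step t t' \<Longrightarrow> evals t n \<Longrightarrow> evals t' n"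
  using evals_reducible step_unique by blast

text \<open>
  A term with a value, possibly applied to further arguments.
\<close>

inductive dead :: "tm \<Rightarrow> bool" where
  "evals t n \<Longrightarrow> dead t"
| "dead t \<Longrightarrow> dead (t \<bullet> u)"

lemma not_dead: "\<not> dead FORALL" "\<not> dead REC" "\<not> dead (Op OLam k [b])"
  "\<not> dead (REC \<bullet> g)" "\<not> dead (REC \<bullet> g \<bullet> h)"
  by (auto elim!: dead.cases)

lemma dead_step: "dead t \<Longrightarrow> step t s \<Longrightarrow> dead s"
proof (induction arbitrary: s rule: dead.induct)
  case (1 t n)
  then show ?case using evals_forward dead.intros(1) by blast
next
  case (2 t u)
  from \<open>step (t \<bullet> u) s\<close> show ?case
    by (rule step_appE) (use 2 in \<open>auto simp: not_dead intro: dead.intros\<close>)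
qed

text \<open>
  The value of a term is found by steps of its head. Such steps end in a zero, a successor or a formula,
  or in an application of the quantifier, and never in an abstraction or in a partially applied recursor. Hence
  a further argument gets stuck.
\<close>

lemma dead_app_no_eval: "evals x n \<Longrightarrow> x = t \<bullet> u \<Longrightarrow> dead t \<Longrightarrow> False"
proof (induction arbitrary: t u rule: step_evals.inducts(2)[where ?P1.0 = "\<lambda>_ _. True"])
  case (evals_step t0 t' n)
  from \<open>step t0 t'\<close>[unfolded evals_step.prems] show ?case
    by (rule step_appE) (use evals_step dead_step in \<open>auto simp: not_dead\<close>)
qed (auto simp: not_dead)

section \<open>Exchanging subterms of equal value\<close>

text \<open>
  Equality up to any number of exchanges of closed subterms that have the same value.
\<close>

inductive sim :: "tm \<Rightarrow> tm \<Rightarrow> bool" where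
  sim_Var: "sim (Var i) (Var i)"
| sim_Op: "list_all2 sim ts ts' \<Longrightarrow> sim (Op f k ts) (Op f k ts')"
| sim_evals: "closed_tm a \<Longrightarrow> closed_tm b \<Longrightarrow> evals a n \<Longrightarrow> evals b n \<Longrightarrow> sim a b"

lemma sim_refl: "sim t t"
  by (induction t) (auto intro!: sim_Var sim_Op list.rel_refl_strong)

lemma sim_shift: "sim t t' \<Longrightarrow> sim (shift d c t) (shift d c t')"
proof (induction arbitrary: c rule: sim.induct)
  case (sim_Op ts ts' f k)
  then show ?case by (auto intro!: sim.sim_Op simp: list_all2_conv_all_nth)
qed (auto intro: sim.intros)

lemma sim_inst_at: "sim b b' \<Longrightarrow> sim s s' \<Longrightarrow> sim (inst_at c s b) (inst_at c s' b')"
proof (induction arbitrary: c rule: sim.induct)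
  case (sim_Op ts ts' f k)
  then show ?case by (auto intro!: sim.sim_Op simp: list_all2_conv_all_nth)
qed (auto intro: sim.intros sim_shift)

inductive_cases sim_OpE: "sim (Op f k ts) t"

lemma sim_Op_evals:
  assumes "sim (Op f k ts) t'" "evals (Op f k ts) n"
    and "\<And>ts'. t' = Op f k ts' \<Longrightarrow> list_all2 sim ts ts' \<Longrightarrow> evals (Op f k ts') n"
  shows "evals t' n"
  using assms evals_unique by (elim sim_OpE) blast+

lemma sim_APP: "sim t t' \<Longrightarrow> sim u u' \<Longrightarrow> sim (t \<bullet> u) (t' \<bullet> u')"
  by (auto intro!: sim_Op)

lemma sim_appE:
  assumes "sim (t \<bullet> u) s"
  obtains (evals) n where "evals (t \<bullet> u) n" "evals s n"
  | (app) t' u' where "s = t' \<bullet> u'" "sim t t'" "sim u u'"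
  using assms by (elim sim_OpE) (auto simp: list_all2_Cons1)

lemma sim_REC_app:
  assumes "sim (REC \<bullet> g \<bullet> h) t" obtains g' h' where "t = REC \<bullet> g' \<bullet> h'" "sim g g'" "sim h h'"
  using assms by (auto elim!: sim_appE) (auto elim: sim_OpE)

lemma sim_LAM:
  assumes "sim (Op OLam k [b]) t" obtains b' where "t = Op OLam k [b']" "sim b b'"
  using assms by (auto elim!: sim_OpE simp: list_all2_Cons1)

text \<open>
  Evaluation does not see the exchange. Two cases are interesting. If the exchanged subterm is at the head
  of an application, then the function part is dead and the application has no value. If it is the last argument
  of a recursor, then it has to be in evaluation rather than in numeral form, which \<open>step\<close> permits. The
  determinism of evaluation covers the case where the whole term is exchanged.
\<close>

lemma sim_step_evals:
  "step t s \<Longrightarrow> (\<forall>t1 u t1' u'. t = t1 \<bullet> u \<longrightarrow> sim t1 t1' \<longrightarrow> sim u u' \<longrightarrow>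
      dead t1 \<or> (\<exists>s'. step (t1' \<bullet> u') s' \<and> sim s s'))"
  "evals t n \<Longrightarrow> (\<forall>t'. sim t t' \<longrightarrow> evals t' n)"
proof (induction rule: step_evals.inducts)
  case (step_beta b t)
  then show ?case by (auto elim!: sim_LAM intro!: step_evals.step_beta[simplified] sim_inst_at exI)
next
  case (step_rec_zero m g h)
  then show ?case by (auto elim!: sim_REC_app intro!: step_evals.step_rec_zero exI)
next
  case (step_rec_suc m k g h)
  then show ?case
    by (auto elim!: sim_REC_app intro!: step_evals.step_rec_suc exI sim_APP sim_refl)
next
  case (step_app t t' u)
  show ?case
  proof (intro allI impI)
    fix t1 u1 t1' u'
    assume *: "t \<bullet> u = t1 \<bullet> u1" and sim: "sim t1 t1'" "sim u1 u'"
    from step_app obtain t2 v where t: "t = t2 \<bullet> v" using step_source by blast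
    from sim have "sim (t2 \<bullet> v) t1'" using * t by simp
    then show "dead t1 \<or> (\<exists>s'. step (t1' \<bullet> u') s' \<and> sim (t' \<bullet> u) s')"
    proof (cases rule: sim_appE)
      case (evals n)
      then show ?thesis using * t dead.intros by auto
    next
      case (app t2' v')
      then have "dead t2 \<or> (\<exists>s'. step (t2' \<bullet> v') s' \<and> sim t' s')"
        using step_app.IH t by blast
      then show ?thesis
        using * t app sim dead.intros by (auto intro!: sim_APP dest: step_evals.step_app)
    qed
  qed
next
  case evals_zero
  then show ?case by (auto elim!: sim_OpE dest: evals_unique intro: step_evals.evals_zero)
next
  case (evals_suc t n)
  show ?case
    by (intro allI impI, erule sim_Op_evals)
      (use evals_suc step_evals.evals_suc in \<open>auto simp: list_all2_Cons1\<close>)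
next
  case (evals_neg1 t)
  show ?case
    by (intro allI impI, erule sim_Op_evals)
      (use evals_neg1 step_evals.evals_neg1 in \<open>auto simp: list_all2_Cons1\<close>)
next
  case (evals_neg0 t)
  show ?case
    by (intro allI impI, erule sim_Op_evals)
      (use evals_neg0 step_evals.evals_neg0 in \<open>auto simp: list_all2_Cons1\<close>)
next
  case (evals_or1 t u)
  show ?case
    by (intro allI impI, erule sim_Op_evals)
      (use evals_or1 step_evals.evals_or1 in \<open>auto simp: list_all2_Cons1\<close>)
next
  case (evals_or2 u t)
  show ?case
    by (intro allI impI, erule sim_Op_evals)
      (use evals_or2 step_evals.evals_or2 in \<open>auto simp: list_all2_Cons1\<close>)
next
  case (evals_or0 u t)
  show ?case
    by (intro allI impI, erule sim_Op_evals)
      (use evals_or0 step_evals.evals_or0 in \<open>auto simp: list_all2_Cons1\<close>)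
next
  case (evals_eq1 u n t)
  show ?case
    by (intro allI impI, erule sim_Op_evals)
      (use evals_eq1 step_evals.evals_eq1 in \<open>auto simp: list_all2_Cons1\<close>)
next
  case (evals_eq0 u n t m)
  show ?case
    by (intro allI impI, erule sim_Op_evals)
      (use evals_eq0 step_evals.evals_eq0[OF _ _ \<open>n \<noteq> m\<close>] in \<open>auto simp: list_all2_Cons1\<close>)
next
  case (evals_all1 f)
  have *: "evals (FORALL \<bullet> f) (Suc 0)" using evals_all1 step_evals.evals_all1 by blast
  show ?case
  proof (intro allI impI)
    fix t' assume "sim (FORALL \<bullet> f) t'"
    then show "evals t' (Suc 0)"
    proof (cases rule: sim_appE)
      case (evals n)
      then show ?thesis using evals_unique * by blast
    next
      case (app A f')
      then have "A = FORALL" by (auto elim: sim_OpE)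
      then show ?thesis using app evals_all1.IH
        by (auto intro!: step_evals.evals_all1 sim_APP sim_refl)
    qed
  qed
next
  case (evals_all0 f i)
  have *: "evals (FORALL \<bullet> f) 0" using evals_all0 step_evals.evals_all0 by blast
  show ?case
  proof (intro allI impI)
    fix t' assume "sim (FORALL \<bullet> f) t'"
    then show "evals t' 0"
    proof (cases rule: sim_appE)
      case (evals n)
      then show ?thesis using evals_unique * by blast
    next
      case (app A f')
      then have "A = FORALL" by (auto elim: sim_OpE)
      then show ?thesis using app evals_all0.IH
        by (auto intro!: step_evals.evals_all0 sim_APP sim_refl)
    qed
  qed
next
  case (evals_step t s n)
  then obtain t1 u where t: "t = t1 \<bullet> u" using step_source by blast
  have *: "evals (t1 \<bullet> u) n" using evals_step step_evals.evals_step t by blast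
  show ?case
  proof (intro allI impI)
    fix t' assume "sim t t'"
    then have "sim (t1 \<bullet> u) t'" using t by simp
    then show "evals t' n"
    proof (cases rule: sim_appE)
      case (evals n)
      then show ?thesis using evals_unique * by blast
    next
      case (app t1' u')
      then show ?thesis using evals_step.IH t dead_app_no_eval[OF *] step_evals.evals_step by blast
    qed
  qed
qed

lemmas sim_evals_transfer = sim_step_evals(2)[rule_format]

lemma sim_csub: "(\<And>i. sim (\<sigma> i) (\<tau> i)) \<Longrightarrow> sim (csub c \<sigma> t) (csub c \<tau> t)"
  by (induction t arbitrary: c) (auto intro!: sim_Var sim_Op simp: list_all2_conv_all_nth)

text \<open>
  The last argument in a head step of the recursor is a numeral, which evaluates to itself.
\<close>

lemma head_step_csub:
  assumes "\<forall>i. closed_tm (\<sigma> i)"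
  shows "c \<triangleright> c' \<Longrightarrow> step (csub 0 \<sigma> c) (csub 0 \<sigma> c')"
proof (induction rule: head_step.induct)
  case (beta t b)
  then show ?case using step_beta[of "csub 1 \<sigma> b" "csub 0 \<sigma> t"] csub_inst_at[OF assms, of 0]
    by simp
qed (auto intro: step_rec_zero step_rec_suc[of "SUC (num n)" n for n] step_app evals_zero evals_suc evals_num)

section \<open>Soundness and consistency\<close>

text \<open>
  Variables range over all closed terms, not just over numerals, because the substitution rule allows
  them to be replaced by terms without a value.
\<close>

definition models :: "(nat \<Rightarrow> tm) \<Rightarrow> tm fset \<Rightarrow> bool" where
  "models \<sigma> \<Gamma> \<longleftrightarrow> (\<forall>i. closed_tm (\<sigma> i)) \<and> (\<forall>a \<in> fset \<Gamma>. evals (csub 0 \<sigma> a) 1)"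

fun valid :: "sequent \<Rightarrow> bool" where
  "valid (\<Gamma> \<turnstile> c) \<longleftrightarrow> (\<forall>\<sigma>. models \<sigma> \<Gamma> \<longrightarrow> evals (csub 0 \<sigma> c) 1)"

lemma models_transfer:
  assumes \<sigma>: "\<forall>i. closed_tm (\<sigma> i)" and "closed_tm a" "closed_tm b" "evals a n" "evals b n"
    and "evals (csub 0 (\<sigma>(v := a)) p) m"
  shows "evals (csub 0 (\<sigma>(v := b)) p) m"
proof -
  have "sim (csub 0 (\<sigma>(v := a)) p) (csub 0 (\<sigma>(v := b)) p)"
    by (rule sim_csub) (use assms in \<open>auto intro: sim_evals sim_refl\<close>)
  then show ?thesis using assms sim_evals_transfer by blast
qed

lemma models_closed: "models \<sigma> \<Gamma> \<Longrightarrow> \<forall>i. closed_tm (\<sigma> i)"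
  by (simp add: models_def)

lemma models_finsert:
  "models \<sigma> (finsert a \<Gamma>) \<longleftrightarrow> models \<sigma> \<Gamma> \<and> evals (csub 0 \<sigma> a) (Suc 0)"
  by (auto simp: models_def)

lemma models_up:
  assumes "models \<sigma> \<Gamma>" shows "models (case_nat (num n) \<sigma>) (up |`| \<Gamma>)"
proof -
  have "csub 0 (case_nat (num n) \<sigma>) (up a) = csub 0 \<sigma> a" for a
    using csub_up[of 0] by simp
  then show ?thesis using assms by (auto simp: models_def fimage.rep_eq split: nat.split)
qed

lemma evals_isN: "evals t n \<Longrightarrow> evals (t \<^bold>= t) (Suc 0)"
  by (rule evals_eq1)

lemma evals_isND: "evals (t \<^bold>= t) (Suc 0) \<Longrightarrow> \<exists>n. evals t n"
  by (auto dest: evals_eqD)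

lemma evals_eq1D: "evals (t \<^bold>= u) (Suc 0) \<Longrightarrow> \<exists>n. evals t n \<and> evals u n"
  by (auto dest!: evals_eqD split: if_splits)

lemma evals_eq0D: "evals (t \<^bold>= u) 0 \<Longrightarrow> \<exists>n m. evals t n \<and> evals u m \<and> n \<noteq> m"
  by (drule evals_eqD) (metis nat.distinct(1))

lemma evals_neg_iff: "evals (NEG t) (Suc 0) \<longleftrightarrow> evals t 0" "evals (NEG t) 0 \<longleftrightarrow> evals t (Suc 0)"
  by (auto dest: evals_negD intro: evals_neg1 evals_neg0)

lemma evals_or_iff:
  "evals (t \<^bold>\<or> u) (Suc 0) \<longleftrightarrow> evals t (Suc 0) \<or> evals u (Suc 0)"
  "evals (t \<^bold>\<or> u) 0 \<longleftrightarrow> evals t 0 \<and> evals u 0"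
  by (auto dest: evals_orD intro: evals_or1 evals_or2 evals_or0)

lemma evals_suc_iff: "evals (SUC t) (Suc n) \<longleftrightarrow> evals t n" "\<not> evals (SUC t) 0"
  by (auto dest: evals_sucD intro: evals_suc)

lemma evals_FORALL_iff:
  "evals (FORALL \<bullet> f) (Suc 0) \<longleftrightarrow> (\<forall>n. evals (f \<bullet> num n) (Suc 0))"
  "evals (FORALL \<bullet> f) 0 \<longleftrightarrow> (\<exists>n. evals (f \<bullet> num n) 0)"
  by (auto dest: evals_FORALL intro: evals_all1 evals_all0)

lemma evals_app_num:
  assumes "closed_tm f" "closed_tm a" "evals a n"
  shows "evals (f \<bullet> a) m \<longleftrightarrow> evals (f \<bullet> num n) m"
  using assms by (meson closed_num evals_num sim_APP sim_evals sim_evals_transfer sim_refl)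

lemma evals_eq_num: "evals (t \<^bold>= num n) (Suc 0) \<longleftrightarrow> evals t n"
  using evals_eq1[OF _ evals_num] evals_eq1D evals_num evals_unique by blast

lemmas evals_eq_01 = evals_eq_num[of _ 0, simplified] evals_eq_num[of _ "Suc 0", simplified]

text \<open>
  The quantifier and induction rules add the hypothesis that a variable is a number; it is enough to
  use them with numerals, since the other terms with a value can be exchanged for their numeral.
\<close>

lemma valid_rule:
  assumes "rga_rule Js J" "\<forall>J' \<in> set Js. valid J'"
  shows "valid J"
  using assms
proof (cases rule: rga_rule.cases)
  case (substitution \<Gamma> c s v)
  show ?thesis unfolding substitution valid.simps
  proof (intro allI impI)
    fix \<sigma> assume m: "models \<sigma> (subst v s |`| \<Gamma>)"
    then have "models (\<sigma>(v := csub 0 \<sigma> s)) \<Gamma>"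
      by (auto simp: models_def fimage.rep_eq csub_subst0)
    then show "evals (csub 0 \<sigma> (subst v s c)) 1"
      using substitution assms(2) by (auto simp: csub_subst0)
  qed
next
  case (eq_subst p \<Gamma> a b v)
  show ?thesis unfolding eq_subst valid.simps
  proof (intro allI impI)
    fix \<sigma> assume m: "models \<sigma> \<Gamma>"
    then obtain n where "evals (csub 0 \<sigma> a) n" "evals (csub 0 \<sigma> b) n"
      and "evals (csub 0 (\<sigma>(v := csub 0 \<sigma> a)) p) 1"
      using eq_subst assms(2) evals_eq1D by (fastforce simp: csub_subst0)
    then show "evals (csub 0 \<sigma> (subst v b p)) 1"
      unfolding csub_subst0 using m models_transfer[of \<sigma> "csub 0 \<sigma> a" "csub 0 \<sigma> b" n]
      by (auto simp: models_def)
  qed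
next
  case (nat_induction c i \<Gamma> a)
  show ?thesis unfolding nat_induction valid.simps
  proof (intro allI impI)
    fix \<sigma> assume m: "models \<sigma> \<Gamma>"
    then have cl: "\<forall>i. closed_tm (\<sigma> i)" by (simp add: models_def)
    have step: "evals (csub 0 (\<sigma>(i := num n)) c) 1" for n
    proof (induction n)
      case 0
      have "evals (csub 0 \<sigma> (subst i ZERO c)) 1" using nat_induction assms(2) m by auto
      then show ?case by (simp add: csub_subst0 fun_upd_def)
    next
      case (Suc n)
      let ?\<tau> = "\<sigma>(i := num n)"
      have "csub 0 ?\<tau> x = csub 0 \<sigma> x" if "x \<in> fset \<Gamma>" for x
        by (rule csub_fresh) (use nat_induction(4) that in auto)
      then have "models ?\<tau> \<Gamma>" using m by (auto simp: models_def)
      then have "models ?\<tau> (finsert (isN (Var i)) (finsert c \<Gamma>))"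
        using Suc evals_isN[OF evals_num] by (simp add: models_finsert fun_upd_def)
      then have "evals (csub 0 ?\<tau> (subst i (SUC (Var i)) c)) 1"
        using nat_induction assms(2) by auto
      then show ?case by (simp add: csub_subst0 fun_upd_def cong: if_cong)
    qed
    obtain n where "evals (csub 0 \<sigma> a) n"
      using nat_induction assms(2) m evals_isND by fastforce
    then show "evals (csub 0 \<sigma> (subst i a c)) 1"
      unfolding csub_subst0 using step[of n] cl evals_num
      by (auto intro: models_transfer[of \<sigma> "num n" _ n])
  qed
next
  case (conv_expand c c' \<Gamma>)
  then show ?thesis using assms(2) by simp (meson models_closed head_step_csub evals_step)
next
  case (conv_reduce c c' \<Gamma>)
  then show ?thesis using assms(2) by simp (meson models_closed head_step_csub evals_forward)
next
  case (conv_eq c c' \<Gamma>)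
  show ?thesis unfolding conv_eq valid.simps
  proof (intro allI impI)
    fix \<sigma> assume m: "models \<sigma> \<Gamma>"
    then obtain n where "evals (csub 0 \<sigma> c') n"
      using conv_eq assms(2) evals_isND by fastforce
    moreover have "step (csub 0 \<sigma> c) (csub 0 \<sigma> c')"
      using conv_eq m head_step_csub by (auto simp: models_def)
    ultimately show "evals (csub 0 \<sigma> (c \<^bold>= c')) 1"
      by (auto intro: evals_eq1 evals_step)
  qed
next
  case (recursor g \<Gamma> m h)
  show ?thesis unfolding recursor valid.simps
  proof (intro allI impI)
    fix \<sigma> assume mo: "models \<sigma> \<Gamma>"
    let ?s = "csub 0 \<sigma>"
    have cl: "closed_tm (?s g)" "closed_tm (?s h)" "closed_tm (?s m)"
      using mo by (auto simp: models_def)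
    obtain k where k: "evals (?s m) k"
      using recursor assms(2) mo evals_isND by fastforce
    obtain n where n: "evals (?s h \<bullet> ?s m \<bullet> (REC \<bullet> ?s g \<bullet> ?s h \<bullet> ?s m)) n"
      using recursor assms(2) mo evals_isND by fastforce
    have "sim (?s m) (num k)" using k cl evals_num by (auto intro: sim_evals)
    then have "sim (?s h \<bullet> ?s m \<bullet> (REC \<bullet> ?s g \<bullet> ?s h \<bullet> ?s m))
        (?s h \<bullet> num k \<bullet> (REC \<bullet> ?s g \<bullet> ?s h \<bullet> num k))"
      by (intro sim_APP sim_refl)
    then have "evals (?s h \<bullet> num k \<bullet> (REC \<bullet> ?s g \<bullet> ?s h \<bullet> num k)) n"
      using n sim_evals_transfer by blast
    then have "evals (REC \<bullet> ?s g \<bullet> ?s h \<bullet> SUC (?s m)) n"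
      using k evals_suc step_rec_suc evals_step by blast
    then show "evals (?s (REC \<bullet> g \<bullet> h \<bullet> SUC m \<^bold>= h \<bullet> m \<bullet> (REC \<bullet> g \<bullet> h \<bullet> m))) 1"
      using n by (auto intro: evals_eq1)
  qed
next
  case (all_intro \<Gamma> f)
  show ?thesis unfolding all_intro valid.simps
  proof (intro allI impI)
    fix \<sigma> assume m: "models \<sigma> \<Gamma>"
    have "evals (csub 0 \<sigma> f \<bullet> num n) (Suc 0)" for n
    proof -
      have "models (case_nat (num n) \<sigma>) (finsert (isN (Var 0)) (up |`| \<Gamma>))"
        using models_up[OF m] evals_isN[OF evals_num] by (simp add: models_finsert)
      then have "evals (csub 0 (case_nat (num n) \<sigma>) (up f \<bullet> Var 0)) 1"
        using all_intro assms(2) by auto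
      then show ?thesis using csub_up[of 0 "num n" \<sigma> f] by simp
    qed
    then show "evals (csub 0 \<sigma> (FORALL \<bullet> f)) 1" by (simp add: evals_FORALL_iff)
  qed
next
  case (all_elim \<Gamma> f a)
  show ?thesis unfolding all_elim valid.simps
  proof (intro allI impI)
    fix \<sigma> assume m: "models \<sigma> \<Gamma>"
    obtain n where "evals (csub 0 \<sigma> a) n" "evals (csub 0 \<sigma> (FORALL \<bullet> f)) 1"
      using all_elim assms(2) m evals_isND by fastforce
    then show "evals (csub 0 \<sigma> (f \<bullet> a)) 1"
      using m evals_app_num[of "csub 0 \<sigma> f" "csub 0 \<sigma> a" n]
      by (simp add: evals_FORALL_iff models_def)
  qed
next
  case (nall_intro \<Gamma> f a)
  show ?thesis unfolding nall_intro valid.simps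
  proof (intro allI impI)
    fix \<sigma> assume m: "models \<sigma> \<Gamma>"
    obtain n where "evals (csub 0 \<sigma> a) n" "evals (csub 0 \<sigma> (NEG (f \<bullet> a))) 1"
      using nall_intro assms(2) m evals_isND by fastforce
    then show "evals (csub 0 \<sigma> (NEG (FORALL \<bullet> f))) 1"
      using m evals_app_num[of "csub 0 \<sigma> f" "csub 0 \<sigma> a" n]
      by (auto simp: evals_FORALL_iff evals_neg_iff models_def)
  qed
next
  case (nall_elim \<Gamma> f c)
  show ?thesis unfolding nall_elim valid.simps
  proof (intro allI impI)
    fix \<sigma> assume m: "models \<sigma> \<Gamma>"
    then have "evals (NEG (FORALL \<bullet> csub 0 \<sigma> f)) (Suc 0)"
      using nall_elim assms(2) by auto
    then obtain n where n: "evals (csub 0 \<sigma> f \<bullet> num n) 0"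
      by (auto simp: evals_FORALL_iff evals_neg_iff)
    let ?\<tau> = "case_nat (num n) \<sigma>"
    have "models ?\<tau> (finsert (isN (Var 0)) (finsert (NEG (up f \<bullet> Var 0)) (up |`| \<Gamma>)))"
      using models_up[OF m] evals_isN[OF evals_num] n csub_up[of 0 "num n" \<sigma> f]
      by (simp add: models_finsert evals_neg_iff)
    then have "evals (csub 0 ?\<tau> (up c)) 1"
      using nall_elim assms(2) by auto
    then show "evals (csub 0 \<sigma> c) 1" using csub_up[of 0 "num n" \<sigma> c] by simp
  qed
next
  case (cut \<Gamma> a c)
  then show ?thesis using assms(2) by (auto simp: models_finsert)
next
  case (or_elim \<Gamma> a b c)
  then show ?thesis using assms(2) by (auto simp: models_finsert evals_or_iff)
next
  case (explosion c \<Gamma> a)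
  then show ?thesis using assms(2) by (auto simp: evals_neg_iff dest: evals_unique)
next
  case (bot_nat p \<Gamma>)
  then show ?thesis using assms(2) by (auto dest: evals_isND)
next
  case (eq_bool \<Gamma> a b)
  show ?thesis unfolding eq_bool valid.simps
  proof (intro allI impI)
    fix \<sigma> assume m: "models \<sigma> \<Gamma>"
    then obtain n k where "evals (csub 0 \<sigma> a) n" "evals (csub 0 \<sigma> b) k"
      using eq_bool assms(2) evals_isND by fastforce
    then show "evals (csub 0 \<sigma> (isB (a \<^bold>= b))) 1"
      by (cases "n = k") (auto simp: evals_or_iff evals_neg_iff intro: evals_eq1 evals_eq0)
  qed
next
  case (eq_bool_elim \<Gamma> a b)
  then show ?thesis using assms(2)
    by (auto simp: evals_or_iff evals_neg_iff dest!: evals_eq1D evals_eq0D intro: evals_isN)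
next
  case (true_elim \<Gamma> a)
  then show ?thesis using assms(2) by (simp add: evals_eq_01)
qed (use assms(2) in \<open>fastforce
  simp: models_finsert evals_eq_01 evals_or_iff evals_neg_iff evals_suc_iff evals_num
  dest!: evals_eq1D evals_eq0D dest: evals_isND evals_sucD
  intro: evals_eq1 evals_eq0 evals_zero evals_isN evals_suc\<close>)+

text \<open>
  Proofs of the premises are concatenated.
\<close>

lemma derivable_rule:
  assumes "rga_rule Js J" "\<forall>J' \<in> set Js. derivable J'"
  shows "derivable J"
proof -
  have "\<exists>P. is_proof P \<and> set Js \<subseteq> set P"
    using assms(2)
  proof (induction Js)
    case Nil
    have "is_proof []" by (simp add: is_proof_def)
    then show ?case by auto
  next
    case (Cons J Js)
    then obtain P Q where PQ: "is_proof P" "set Js \<subseteq> set P" "is_proof Q" "J \<in> set Q"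
      by (auto simp: derivable_def)
    have "\<exists>Ks. set Ks \<subseteq> set (take i (P @ Q)) \<and> rga_rule Ks ((P @ Q) ! i)"
      if "i < length (P @ Q)" for i
    proof (cases "i < length P")
      case True
      then show ?thesis using PQ(1) by (fastforce simp: is_proof_def nth_append)
    next
      case False
      then have "i - length P < length Q" using that by simp
      then obtain Ks where "set Ks \<subseteq> set (take (i - length P) Q)" "rga_rule Ks (Q ! (i - length P))"
        using PQ(3) unfolding is_proof_def by blast
      then show ?thesis using False by (intro exI[of _ Ks]) (auto simp: nth_append)
    qed
    then have "is_proof (P @ Q)" by (simp add: is_proof_def)
    then show ?case using PQ by (intro exI[of _ "P @ Q"]) auto
  qed
  then obtain P where P: "is_proof P" "set Js \<subseteq> set P" by blast
  have "is_proof (P @ [J])"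
    using P assms(1) unfolding is_proof_def
    by (auto simp: nth_append less_Suc_eq)
  then show ?thesis by (auto simp: derivable_def)
qed

lemma derivable_induct [consumes 1, case_names rule]:
  assumes "derivable J"
    and step: "\<And>Js J. rga_rule Js J \<Longrightarrow> \<forall>J' \<in> set Js. Q J' \<Longrightarrow> Q J"
  shows "Q J"
proof -
  obtain P where P: "is_proof P" "J \<in> set P" using assms(1) by (auto simp: derivable_def)
  have "i < length P \<Longrightarrow> Q (P ! i)" for i
  proof (induction i rule: less_induct)
    case (less i)
    then obtain Js where "set Js \<subseteq> set (take i P)" "rga_rule Js (P ! i)"
      using P(1) by (auto simp: is_proof_def)
    moreover have "Q J'" if "J' \<in> set (take i P)" for J'
      using that less by (auto simp: in_set_conv_nth)
    ultimately show ?case by (intro step) auto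
  qed
  then show ?thesis using P(2) by (auto simp: in_set_conv_nth)
qed

lemma derivable_valid: "derivable J \<Longrightarrow> valid J"
  by (induction rule: derivable_induct) (rule valid_rule)

text \<open>
  In the standard model the equation \<open>0 = 1\<close> has the value \<open>0\<close>.
\<close>

lemma consistent: "\<not> derivable ({||} \<turnstile> ZERO \<^bold>= SUC ZERO)"
proof
  assume "derivable ({||} \<turnstile> ZERO \<^bold>= SUC ZERO)"
  then have "valid ({||} \<turnstile> ZERO \<^bold>= SUC ZERO)" by (rule derivable_valid)
  moreover have "models (\<lambda>_. ZERO) {||}" by (simp add: models_def closed_tm_def)
  ultimately have "evals (ZERO \<^bold>= SUC ZERO) (Suc 0)" by fastforce
  then show False by (auto simp: evals_suc_iff dest!: evals_eq1D elim: evals_opE dest: evals_sucD)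
     (metis evals_num evals_sucD evals_unique nat.distinct(1) num.simps(1))
qed

section \<open>Head reduction with closed arguments\<close>

abbreviation reds :: "tm \<Rightarrow> tm \<Rightarrow> bool" (infix "\<triangleright>*" 50) where
  "t \<triangleright>* t' \<equiv> head_step\<^sup>*\<^sup>* t t'"

text \<open>
  Well-formedness is the side condition of \<open>\<beta>\<close>-steps; closedness makes substitution leave arguments
  unchanged.
\<close>

definition closed_wf :: "tm \<Rightarrow> bool" where
  "closed_wf t \<longleftrightarrow> closed_tm t \<and> wf_tm t"

lemma closed_wf_I: "fv t = {} \<Longrightarrow> wf_tm t \<Longrightarrow> closed_wf t"
  by (simp add: closed_wf_def closed_tm_def)

lemma closed_wf_app [simp]: "closed_wf (t \<bullet> u) \<longleftrightarrow> closed_wf t \<and> closed_wf u"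
  by (auto simp: closed_wf_def closed_tm_def)

lemma closed_wf_closed [simp]: "closed_wf t \<Longrightarrow> closed_tm t"
  and closed_wf_wf [simp]: "closed_wf t \<Longrightarrow> wf_tm t"
  by (simp_all add: closed_wf_def)

lemma closed_wf_fv [simp]: "closed_wf t \<Longrightarrow> fv t = {}"
  by (simp add: closed_wf_def closed_tm_def)

lemma closed_wf_select: "closed_wf (LAM (LAM (Var 0)))" "closed_wf (LAM (LAM (Var 1)))"
  by (auto intro!: closed_wf_I)

lemmas closed_wf_select' [simp] = closed_wf_select closed_wf_select[simplified]

lemma reds_app: "t \<triangleright>* t' \<Longrightarrow> t \<bullet> u \<triangleright>* t' \<bullet> u"
  by (induction rule: rtranclp_induct) (auto intro: head_step.app rtranclp.rtrancl_into_rtrancl)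

lemma reds_beta1: "closed_wf a \<Longrightarrow> LAM t \<bullet> a \<triangleright>* inst_at 0 a t"
  by (blast intro: head_step.beta closed_wf_wf)

lemma reds_beta2: "closed_wf a \<Longrightarrow> closed_wf b \<Longrightarrow> LAM (LAM t) \<bullet> a \<bullet> b \<triangleright>* inst_at 0 b (inst_at 1 a t)"
  using reds_app[OF reds_beta1[of a "LAM t"], of b] reds_beta1[of b "inst_at 1 a t"]
  by simp

lemma reds_beta3:
  "closed_wf a \<Longrightarrow> closed_wf b \<Longrightarrow> closed_wf c \<Longrightarrow>
    LAM (LAM (LAM t)) \<bullet> a \<bullet> b \<bullet> c \<triangleright>* inst_at 0 c (inst_at 1 b (inst_at 2 a t))"
  using reds_app[OF reds_beta1[of a "LAM (LAM t)"], THEN reds_app, of b c]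
    reds_beta2[of b c "inst_at 2 a t"]
  by (simp add: numeral_2_eq_2)

lemma reds_beta4:
  "closed_wf a \<Longrightarrow> closed_wf b \<Longrightarrow> closed_wf c \<Longrightarrow> closed_wf d \<Longrightarrow>
    LAM (LAM (LAM (LAM t))) \<bullet> a \<bullet> b \<bullet> c \<bullet> d \<triangleright>*
      inst_at 0 d (inst_at 1 c (inst_at 2 b (inst_at 3 a t)))"
  using reds_app[OF reds_beta1[of a "LAM (LAM (LAM t))"], THEN reds_app, THEN reds_app, of b c d]
    reds_beta3[of b c d "inst_at 3 a t"]
  by (simp add: numeral_2_eq_2 numeral_3_eq_3)

lemma reds_beta5:
  "closed_wf a \<Longrightarrow> closed_wf b \<Longrightarrow> closed_wf c \<Longrightarrow> closed_wf d \<Longrightarrow> closed_wf e \<Longrightarrow>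
    LAM (LAM (LAM (LAM (LAM t)))) \<bullet> a \<bullet> b \<bullet> c \<bullet> d \<bullet> e \<triangleright>*
      inst_at 0 e (inst_at 1 d (inst_at 2 c (inst_at 3 b (inst_at 4 a t))))"
  using reds_app[OF reds_beta1[of a "LAM (LAM (LAM (LAM t)))"],
      THEN reds_app, THEN reds_app, THEN reds_app, of b c d e]
    reds_beta4[of b c d e "inst_at 4 a t"]
  by (simp add: eval_nat_numeral)

section \<open>Representing data and functions by terms\<close>

text \<open>
  \<open>rep x t\<close>: the closed term \<open>t\<close> represents \<open>x\<close>. The closure of representations under expansion
  is what allows call-by-name computation: an argument need not be reduced before it is passed on.
\<close>

class rep =
  fixes rep :: "'a \<Rightarrow> tm \<Rightarrow> bool"
  assumes rep_closed_wf: "rep x t \<Longrightarrow> closed_wf t"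
    and rep_reds: "closed_wf t \<Longrightarrow> t \<triangleright>* t' \<Longrightarrow> rep x t' \<Longrightarrow> rep x t"

instantiation "fun" :: (rep, rep) rep
begin
definition rep_fun_def: "rep f F \<longleftrightarrow> closed_wf F \<and> (\<forall>x t. rep x t \<longrightarrow> rep (f x) (F \<bullet> t))"
instance
proof
  fix f :: "'a \<Rightarrow> 'b" and F F'
  show "closed_wf F" if "rep f F" using that by (simp add: rep_fun_def)
  assume F: "closed_wf F" "F \<triangleright>* F'" "rep f F'"
  have "rep (f x) (F \<bullet> t)" if "rep x t" for x t
    by (rule rep_reds[OF _ reds_app[OF F(2)]]) (use F that rep_closed_wf in \<open>auto simp: rep_fun_def\<close>)
  then show "rep f F" using F(1) by (simp add: rep_fun_def)
qed
end

lemma rep_app: "rep f F \<Longrightarrow> rep x t \<Longrightarrow> rep (f x) (F \<bullet> t)"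
  by (simp add: rep_fun_def)

lemma rep_funI: "closed_wf F \<Longrightarrow> (\<And>x t. rep x t \<Longrightarrow> rep (f x) (F \<bullet> t)) \<Longrightarrow> rep f F"
  by (simp add: rep_fun_def)

lemma rep_fun1I:
  assumes "closed_wf (LAM T)" and "\<And>x a. rep x a \<Longrightarrow> rep (f x) (inst_at 0 a T)"
  shows "rep f (LAM T)"
  using assms by (intro rep_funI rep_reds[OF _ reds_beta1]) (auto dest: rep_closed_wf)

lemma rep_fun2I:
  assumes "closed_wf (LAM (LAM T))"
    and "\<And>x a y b. rep x a \<Longrightarrow> rep y b \<Longrightarrow> rep (f x y) (inst_at 0 b (inst_at 1 a T))"
  shows "rep f (LAM (LAM T))"
  using assms by (intro rep_funI rep_reds[OF _ reds_beta2]) (auto dest: rep_closed_wf)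

lemma rep_fun3I:
  assumes "closed_wf (LAM (LAM (LAM T)))"
    and "\<And>x a y b z c. rep x a \<Longrightarrow> rep y b \<Longrightarrow> rep z c \<Longrightarrow>
      rep (f x y z) (inst_at 0 c (inst_at 1 b (inst_at 2 a T)))"
  shows "rep f (LAM (LAM (LAM T)))"
  using assms by (intro rep_funI rep_reds[OF _ reds_beta3]) (auto dest: rep_closed_wf)

instantiation bool :: rep
begin
definition rep_bool_def:
  "rep b t \<longleftrightarrow> closed_wf t \<and> (\<forall>x y. closed_wf x \<longrightarrow> closed_wf y \<longrightarrow> t \<bullet> x \<bullet> y \<triangleright>* (if b then x else y))"
instance
  by standard (auto simp: rep_bool_def intro: rtranclp_trans[OF reds_app[OF reds_app]])
end

instantiation prod :: (rep, rep) rep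
begin
definition rep_prod_def:
  "rep p t \<longleftrightarrow> closed_wf t \<and> (\<exists>a b. rep (fst p) a \<and> rep (snd p) b \<and>
    (\<forall>k. closed_wf k \<longrightarrow> t \<bullet> k \<triangleright>* k \<bullet> a \<bullet> b))"
instance
proof
  fix p :: "'a \<times> 'b" and t t'
  show "closed_wf t" if "rep p t" using that by (simp add: rep_prod_def)
  assume "closed_wf t" "t \<triangleright>* t'" "rep p t'"
  then show "rep p t" using rtranclp_trans[OF reds_app]
    unfolding rep_prod_def by metis
qed
end

text \<open>
  A number is represented by its own recursor: applied to \<open>z\<close> and \<open>s\<close>, the representation of
  \<open>n + 1\<close> reduces to \<open>s\<close> applied to a representation of \<open>n\<close> and to the result of the recursion there.
  With this mixture of the Church and Scott encodings, primitive recursion is mere application and no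
  fixed point combinator is needed. Lists and terms are treated in the same way.
\<close>

primrec rep_nat_at :: "nat \<Rightarrow> tm \<Rightarrow> bool" where
  "rep_nat_at 0 t \<longleftrightarrow> closed_wf t \<and> (\<forall>z s. closed_wf z \<longrightarrow> closed_wf s \<longrightarrow> t \<bullet> z \<bullet> s \<triangleright>* z)"
| "rep_nat_at (Suc n) t \<longleftrightarrow> closed_wf t \<and> (\<exists>m. rep_nat_at n m \<and>
    (\<forall>z s. closed_wf z \<longrightarrow> closed_wf s \<longrightarrow> t \<bullet> z \<bullet> s \<triangleright>* s \<bullet> m \<bullet> (m \<bullet> z \<bullet> s)))"

instantiation nat :: rep
begin
definition rep_nat_def: "rep n t \<longleftrightarrow> rep_nat_at n t"
instance
proof
  fix n :: nat and t t'
  show "closed_wf t" if "rep n t" using that by (cases n) (auto simp: rep_nat_def)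
  assume "closed_wf t" "t \<triangleright>* t'" "rep n t'"
  then show "rep n t" using rtranclp_trans[OF reds_app[OF reds_app]]
    unfolding rep_nat_def by (cases n; simp) metis+
qed
end

text \<open>
  The elements of the list enter through the predicates that recognize their representations, so that
  the definition can be used in the nested recursion for terms below.
\<close>

primrec rep_list_at :: "(tm \<Rightarrow> bool) list \<Rightarrow> tm \<Rightarrow> bool" where
  "rep_list_at [] t \<longleftrightarrow> closed_wf t \<and> (\<forall>n c. closed_wf n \<longrightarrow> closed_wf c \<longrightarrow> t \<bullet> n \<bullet> c \<triangleright>* n)"
| "rep_list_at (P # Ps) t \<longleftrightarrow> closed_wf t \<and> (\<exists>h l. P h \<and> rep_list_at Ps l \<and>
    (\<forall>n c. closed_wf n \<longrightarrow> closed_wf c \<longrightarrow> t \<bullet> n \<bullet> c \<triangleright>* c \<bullet> h \<bullet> l \<bullet> (l \<bullet> n \<bullet> c)))"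

lemma rep_list_at_closed_wf: "rep_list_at Ps t \<Longrightarrow> closed_wf t"
  by (cases Ps) auto

lemma rep_list_at_reds: "closed_wf t \<Longrightarrow> t \<triangleright>* t' \<Longrightarrow> rep_list_at Ps t' \<Longrightarrow> rep_list_at Ps t"
  using rtranclp_trans[OF reds_app[OF reds_app]] by (cases Ps; simp) metis+

instantiation list :: (rep) rep
begin
definition rep_list_def: "rep xs t \<longleftrightarrow> rep_list_at (map rep xs) t"
instance
  by standard (auto simp: rep_list_def intro: rep_list_at_closed_wf rep_list_at_reds)
end

definition pair_tm :: tm where
  "pair_tm = LAM (LAM (LAM (Var 0 \<bullet> Var 2 \<bullet> Var 1)))"

text \<open>
  The first of two arguments; it also represents the number zero.
\<close>

definition nil_tm :: tm where
  "nil_tm = LAM (LAM (Var 1))"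

definition cons_tm :: tm where
  "cons_tm = LAM (LAM (LAM (LAM (Var 0 \<bullet> Var 3 \<bullet> Var 2 \<bullet> (Var 2 \<bullet> Var 1 \<bullet> Var 0)))))"

lemma closed_wf_data [simp]: "closed_wf pair_tm" "closed_wf nil_tm" "closed_wf cons_tm"
  by (auto simp: pair_tm_def nil_tm_def cons_tm_def intro!: closed_wf_I)

lemma rep_Pair: "rep Pair pair_tm"
proof (intro rep_funI)
  fix x :: 'a and a y b assume *: "rep x a" "rep (y::'b) b"
  then have "pair_tm \<bullet> a \<bullet> b \<bullet> k \<triangleright>* k \<bullet> a \<bullet> b" if "closed_wf k" for k
    using reds_beta3[of a b k "Var 0 \<bullet> Var 2 \<bullet> Var 1"] that
    by (simp add: pair_tm_def rep_closed_wf)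
  then show "rep (x, y) (pair_tm \<bullet> a \<bullet> b)"
    using * by (auto simp: rep_prod_def rep_closed_wf)
qed (auto simp: rep_closed_wf)

lemma rep_Nil: "rep [] nil_tm"
  using reds_beta2[of _ _ "Var 1"]
  by (simp add: rep_list_def) (simp add: nil_tm_def)

lemma rep_Cons_at: "closed_wf h \<Longrightarrow> P h \<Longrightarrow> rep_list_at Ps l \<Longrightarrow> rep_list_at (P # Ps) (cons_tm \<bullet> h \<bullet> l)"
  using reds_beta4[of h l _ _ "Var 0 \<bullet> Var 3 \<bullet> Var 2 \<bullet> (Var 2 \<bullet> Var 1 \<bullet> Var 0)"]
  by (simp add: rep_list_at_closed_wf) (auto simp: cons_tm_def rep_list_at_closed_wf)

lemma rep_Cons: "rep (#) cons_tm"
  using rep_Cons_at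
  by (auto intro!: rep_funI simp: rep_closed_wf rep_list_def rep_list_at_closed_wf simp del: rep_list_at.simps)

fun op_index :: "opcode \<Rightarrow> nat" where
  "op_index OBot = 0" | "op_index OZero = 1" | "op_index ORec = 2" | "op_index OAll = 3"
| "op_index OSuc = 4" | "op_index ONeg = 5" | "op_index OLam = 6" | "op_index OEq = 7"
| "op_index OOr = 8" | "op_index OApp = 9" | "op_index (OForeign n) = n + 10"

instantiation opcode :: rep
begin
definition rep_opcode_def: "rep f t \<longleftrightarrow> rep (op_index f) t"
instance by standard (auto simp: rep_opcode_def intro: rep_closed_wf rep_reds)
end

text \<open>
  The step function that turns a list of represented terms \<open>x\<close> into the list of pairs of \<open>x\<close> and the
  result of the recursion at \<open>x\<close>. That list is the third argument of the operator clause in \<open>rec_tm\<close>.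
\<close>

definition paired_tm :: tm where
  "paired_tm = LAM (LAM (LAM (LAM (LAM
    (cons_tm \<bullet> (pair_tm \<bullet> Var 2 \<bullet> (Var 2 \<bullet> Var 4 \<bullet> Var 3)) \<bullet> Var 0)))))"

lemma closed_wf_paired_tm [simp]: "closed_wf paired_tm"
  by (auto simp: paired_tm_def intro!: closed_wf_I)

primrec rep_tm_at :: "tm \<Rightarrow> tm \<Rightarrow> bool" where
  "rep_tm_at (Var i) t \<longleftrightarrow> closed_wf t \<and> (\<exists>a. rep i a \<and>
    (\<forall>v p. closed_wf v \<longrightarrow> closed_wf p \<longrightarrow> t \<bullet> v \<bullet> p \<triangleright>* v \<bullet> a))"
| "rep_tm_at (Op f k ts) t \<longleftrightarrow> closed_wf t \<and> (\<exists>a b l. rep f a \<and> rep k b \<and> rep_list_at (map rep_tm_at ts) l \<and>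
    (\<forall>v p. closed_wf v \<longrightarrow> closed_wf p \<longrightarrow> t \<bullet> v \<bullet> p \<triangleright>* p \<bullet> a \<bullet> b \<bullet> (l \<bullet> nil_tm \<bullet> (paired_tm \<bullet> v \<bullet> p))))"

instantiation tm :: rep
begin
definition rep_tm_def: "rep = rep_tm_at"
instance
proof
  fix x :: tm and t t'
  show "closed_wf t" if "rep x t" using that by (cases x) (auto simp: rep_tm_def)
  assume "closed_wf t" "t \<triangleright>* t'" "rep x t'"
  then show "rep x t" using rtranclp_trans[OF reds_app[OF reds_app]]
    unfolding rep_tm_def by (cases x; simp) metis+
qed
end

section \<open>Computable elements\<close>

definition computable :: "'a::rep \<Rightarrow> bool" where
  "computable x \<longleftrightarrow> (\<exists>t. rep x t)"

lemma computableI: "rep x t \<Longrightarrow> computable x"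
  by (auto simp: computable_def)

lemma computable_id: "computable (\<lambda>x. x)"
  by (rule computableI, rule rep_fun1I[of "Var 0"]) (auto intro!: closed_wf_I)

lemma computable_const: "computable c \<Longrightarrow> computable (\<lambda>_. c)"
  unfolding computable_def
proof (elim exE)
  fix t assume "rep c t"
  then show "\<exists>t. rep (\<lambda>_. c) t"
    by (intro exI[of _ "LAM t"] rep_fun1I) (auto simp: rep_closed_wf intro!: closed_wf_I dest!: rep_closed_wf)
qed

text \<open>
  Together with constant functions and the identity this is the completeness of the combinators \<open>S\<close>, \<open>K\<close>
  and \<open>I\<close>: the variable \<open>x\<close> is the environment in which a compound expression is evaluated.
\<close>

lemma computable_app:
  fixes f :: "'a::rep \<Rightarrow> 'b::rep \<Rightarrow> 'c::rep"
  assumes "computable f" "computable g" shows "computable (\<lambda>x. f x (g x))"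
proof -
  obtain F G where FG: "rep f F" "rep g G" using assms by (auto simp: computable_def)
  have "rep (\<lambda>x. f x (g x)) (LAM (F \<bullet> Var 0 \<bullet> (G \<bullet> Var 0)))"
  proof (rule rep_fun1I)
    fix x :: 'a and a assume "rep x a"
    then show "rep (f x (g x)) (inst_at 0 a (F \<bullet> Var 0 \<bullet> (G \<bullet> Var 0)))"
      using rep_app[OF rep_app[OF FG(1)] rep_app[OF FG(2)]] FG by (simp add: rep_closed_wf)
  qed (use FG in \<open>auto simp: rep_closed_wf intro!: closed_wf_I\<close>)
  then show ?thesis by (rule computableI)
qed

lemma computable_apply: "computable f \<Longrightarrow> computable x \<Longrightarrow> computable (f x)"
  by (auto simp: computable_def intro: rep_app)

lemma computable_unary: "computable f \<Longrightarrow> computable a \<Longrightarrow> computable (\<lambda>p. f (a p))"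
  by (rule computable_app[OF computable_const])

lemma computable_binary: "computable f \<Longrightarrow> computable a \<Longrightarrow> computable b \<Longrightarrow> computable (\<lambda>p. f (a p) (b p))"
  by (rule computable_app[OF computable_unary])

lemma computable_ternary: "computable f \<Longrightarrow> computable a \<Longrightarrow> computable b \<Longrightarrow> computable c \<Longrightarrow>
    computable (\<lambda>p. f (a p) (b p) (c p))"
  by (rule computable_app[OF computable_binary])

lemma computable_Pair: "computable Pair"
  using rep_Pair by (rule computableI)

text \<open>
  A bound variable is eliminated by pairing it with the environment.
\<close>

lemma computable_curry:
  assumes "computable (\<lambda>p. f (fst p) (snd p))" shows "computable f"
proof -
  obtain G where G: "rep (\<lambda>p. f (fst p) (snd p)) G" using assms by (auto simp: computable_def)
  have "rep (f x y) (G \<bullet> (pair_tm \<bullet> a \<bullet> b))" if "rep x a" "rep y b" for x a y b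
    using rep_app[OF G rep_app[OF rep_app[OF rep_Pair that(1)] that(2)]] by simp
  then have "rep f (LAM (LAM (G \<bullet> (pair_tm \<bullet> Var 1 \<bullet> Var 0))))"
    using G by (intro rep_fun2I) (auto simp: rep_closed_wf intro!: closed_wf_I dest: rep_closed_wf)
  then show ?thesis by (rule computableI)
qed

lemma computable_fst: "computable fst"
proof (rule computableI)
  show "rep (fst :: 'a \<times> 'b \<Rightarrow> 'a) (LAM (Var 0 \<bullet> LAM (LAM (Var 1))))"
  proof (rule rep_fun1I)
    fix p :: "'a \<times> 'b" and t assume "rep p t"
    then obtain a b where *: "closed_wf t" "rep (fst p) a" "rep (snd p) b"
      "t \<bullet> LAM (LAM (Var 1)) \<triangleright>* LAM (LAM (Var 1)) \<bullet> a \<bullet> b"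
      by (auto simp: rep_prod_def)
    then have "t \<bullet> LAM (LAM (Var 1)) \<triangleright>* a"
      using reds_beta2[of a b "Var 1"] by (simp add: rep_closed_wf)
    then show "rep (fst p) (inst_at 0 t (Var 0 \<bullet> LAM (LAM (Var 1))))"
      using rep_reds[of _ a "fst p"] * by (simp add: closed_wf_select[simplified])
  qed (auto intro!: closed_wf_I)
qed

lemma computable_snd: "computable snd"
proof (rule computableI)
  show "rep (snd :: 'a \<times> 'b \<Rightarrow> 'b) (LAM (Var 0 \<bullet> LAM (LAM (Var 0))))"
  proof (rule rep_fun1I)
    fix p :: "'a \<times> 'b" and t assume "rep p t"
    then obtain a b where *: "closed_wf t" "rep (fst p) a" "rep (snd p) b"
      "t \<bullet> LAM (LAM (Var 0)) \<triangleright>* LAM (LAM (Var 0)) \<bullet> a \<bullet> b"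
      by (auto simp: rep_prod_def)
    then have "t \<bullet> LAM (LAM (Var 0)) \<triangleright>* b"
      using reds_beta2[of a b "Var 0"] by (simp add: rep_closed_wf)
    then show "rep (snd p) (inst_at 0 t (Var 0 \<bullet> LAM (LAM (Var 0))))"
      using rep_reds[of _ b "snd p"] * by (simp add: closed_wf_select[simplified])
  qed (auto intro!: closed_wf_I)
qed

lemma computable_bool: "computable (b::bool)"
proof (cases b)
  case True
  have "rep True (LAM (LAM (Var 1)))" using reds_beta2[of _ _ "Var 1"]
    by (auto simp: rep_bool_def intro!: closed_wf_I)
  then show ?thesis using True by (auto intro: computableI)
next
  case False
  have "rep False (LAM (LAM (Var 0)))" using reds_beta2[of _ _ "Var 0"]
    by (auto simp: rep_bool_def intro!: closed_wf_I)
  then show ?thesis using False by (auto intro: computableI)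
qed

lemma computable_If: "computable If"
proof (rule computableI)
  show "rep (If :: bool \<Rightarrow> 'a \<Rightarrow> 'a \<Rightarrow> 'a) (LAM (LAM (LAM (Var 2 \<bullet> Var 1 \<bullet> Var 0))))"
  proof (rule rep_fun3I)
    fix b :: bool and t and x :: 'a and a and y :: 'a and c assume *: "rep b t" "rep x a" "rep y c"
    have "t \<bullet> a \<bullet> c \<triangleright>* (if b then a else c)"
      using * rep_closed_wf[OF *(2)] rep_closed_wf[OF *(3)] by (simp add: rep_bool_def)
    moreover have "rep (if b then x else y) (if b then a else c)" using * by simp
    ultimately have "rep (if b then x else y) (t \<bullet> a \<bullet> c)"
      by (rule rep_reds[rotated]) (use rep_closed_wf[OF *(1)] rep_closed_wf[OF *(2)] rep_closed_wf[OF *(3)] in simp)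
    then show "rep (if b then x else y)
        (inst_at 0 c (inst_at 1 a (inst_at 2 t (Var 2 \<bullet> Var 1 \<bullet> Var 0))))"
      using * [THEN rep_closed_wf] by simp
  qed (auto intro!: closed_wf_I)
qed

definition suc_tm :: tm where
  "suc_tm = LAM (LAM (LAM (Var 0 \<bullet> Var 2 \<bullet> (Var 2 \<bullet> Var 1 \<bullet> Var 0))))"

lemma closed_wf_suc_tm [simp]: "closed_wf suc_tm"
  by (auto simp: suc_tm_def intro!: closed_wf_I)

lemma rep_0: "rep (0::nat) nil_tm"
  using reds_beta2[of _ _ "Var 1"]
  by (simp add: rep_nat_def) (simp add: nil_tm_def)

lemma rep_Suc: "rep Suc suc_tm"
proof (rule rep_funI)
  fix n t assume n: "rep (n::nat) t"
  then have "suc_tm \<bullet> t \<bullet> z \<bullet> s \<triangleright>* s \<bullet> t \<bullet> (t \<bullet> z \<bullet> s)" if "closed_wf z" "closed_wf s" for z s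
    using reds_beta3[of t z s "Var 0 \<bullet> Var 2 \<bullet> (Var 2 \<bullet> Var 1 \<bullet> Var 0)"] that
    by (simp add: suc_tm_def rep_closed_wf)
  then show "rep (Suc n) (suc_tm \<bullet> t)"
    using n rep_closed_wf[OF n] by (auto simp: rep_nat_def)
qed simp

lemma rep_rec_nat:
  assumes "rep z Z" "rep s S" "rep n t"
  shows "rep (rec_nat z s n) (t \<bullet> Z \<bullet> S)"
  using \<open>rep n t\<close>
proof (induction n arbitrary: t)
  case 0
  then show ?case using assms
    by (auto simp: rep_nat_def rep_closed_wf intro: rep_reds[of _ Z])
next
  case (Suc n)
  then obtain m where m: "rep n m" "t \<bullet> Z \<bullet> S \<triangleright>* S \<bullet> m \<bullet> (m \<bullet> Z \<bullet> S)"
    using assms by (auto simp: rep_nat_def rep_closed_wf)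
  then have "rep (s n (rec_nat z s n)) (S \<bullet> m \<bullet> (m \<bullet> Z \<bullet> S))"
    using assms(2) Suc.IH rep_app[OF rep_app] by blast
  then show ?case using m assms Suc.prems by (auto simp: rep_closed_wf intro: rep_reds)
qed

lemma computable_rec_nat: "computable rec_nat"
proof (rule computableI)
  show "rep rec_nat (LAM (LAM (LAM (Var 0 \<bullet> Var 2 \<bullet> Var 1))))"
    by (rule rep_fun3I) (auto simp: rep_closed_wf intro!: closed_wf_I rep_rec_nat dest: rep_closed_wf)
qed

lemma rep_rec_list:
  assumes "rep n N" "rep c C" "rep xs t"
  shows "rep (rec_list n c xs) (t \<bullet> N \<bullet> C)"
  using \<open>rep xs t\<close>
proof (induction xs arbitrary: t)
  case Nil
  then show ?case using assms
    by (auto simp: rep_list_def rep_closed_wf intro: rep_reds[of _ N])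
next
  case (Cons x xs)
  then obtain h l where m: "rep x h" "rep xs l" "t \<bullet> N \<bullet> C \<triangleright>* C \<bullet> h \<bullet> l \<bullet> (l \<bullet> N \<bullet> C)"
    using assms by (auto simp: rep_list_def rep_closed_wf)
  then have "rep (c x xs (rec_list n c xs)) (C \<bullet> h \<bullet> l \<bullet> (l \<bullet> N \<bullet> C))"
    using assms(2) Cons.IH rep_app[OF rep_app[OF rep_app]] by blast
  then show ?case using m assms Cons.prems by (auto simp: rep_closed_wf intro: rep_reds)
qed

lemma computable_rec_list: "computable rec_list"
proof (rule computableI)
  show "rep rec_list (LAM (LAM (LAM (Var 0 \<bullet> Var 2 \<bullet> Var 1))))"
    by (rule rep_fun3I) (auto simp: rep_closed_wf intro!: closed_wf_I rep_rec_list dest: rep_closed_wf)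
qed

text \<open>
  The inner induction evaluates the list of recursive results.
\<close>

lemma rep_rec_tm:
  assumes v: "rep v V" and p: "rep p P" and "rep x t"
  shows "rep (rec_tm v p x) (t \<bullet> V \<bullet> P)"
  using \<open>rep x t\<close>
proof (induction x arbitrary: t)
  case (Var i)
  then obtain a where a: "rep i a" "t \<bullet> V \<bullet> P \<triangleright>* V \<bullet> a"
    using assms by (auto simp: rep_tm_def rep_closed_wf)
  then have "rep (v i) (V \<bullet> a)" using v rep_app by blast
  then show ?case using a assms Var.prems by (auto simp: rep_closed_wf intro: rep_reds)
next
  case (Op f k ts)
  then obtain a b l where a: "rep f a" "rep k b" and l: "rep_list_at (map rep ts) l"
    and t: "t \<bullet> V \<bullet> P \<triangleright>* P \<bullet> a \<bullet> b \<bullet> (l \<bullet> nil_tm \<bullet> (paired_tm \<bullet> V \<bullet> P))"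
    using assms by (auto simp: rep_tm_def rep_closed_wf)
  have "rep (map (\<lambda>x. (x, rec_tm v p x)) ts) (l \<bullet> nil_tm \<bullet> (paired_tm \<bullet> V \<bullet> P))"
    using Op.IH l
  proof (induction ts arbitrary: l)
    case Nil
    then show ?case using v p
      by (auto simp: rep_closed_wf intro!: rep_reds[OF _ _ rep_Nil])
  next
    case (Cons x xs)
    then obtain h l' where h: "rep x h" and l': "rep_list_at (map rep xs) l'"
      and l: "closed_wf l" "l \<bullet> nil_tm \<bullet> (paired_tm \<bullet> V \<bullet> P) \<triangleright>*
        paired_tm \<bullet> V \<bullet> P \<bullet> h \<bullet> l' \<bullet> (l' \<bullet> nil_tm \<bullet> (paired_tm \<bullet> V \<bullet> P))"
      using v p by (auto simp: rep_closed_wf)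
    let ?r = "l' \<bullet> nil_tm \<bullet> (paired_tm \<bullet> V \<bullet> P)"
    have cw: "closed_wf V" "closed_wf P" "closed_wf h" "closed_wf l'"
      using v p h l' rep_closed_wf rep_list_at_closed_wf by auto
    have r: "rep (map (\<lambda>x. (x, rec_tm v p x)) xs) ?r"
      using Cons l' by simp
    have "rep (rec_tm v p x) (h \<bullet> V \<bullet> P)" using Cons.prems h by simp
    then have "rep (map (\<lambda>x. (x, rec_tm v p x)) (x # xs))
        (cons_tm \<bullet> (pair_tm \<bullet> h \<bullet> (h \<bullet> V \<bullet> P)) \<bullet> ?r)"
      using h r unfolding list.map
      by (blast intro: rep_app[OF rep_app[OF rep_Cons]] rep_app[OF rep_app[OF rep_Pair]])
    moreover have "paired_tm \<bullet> V \<bullet> P \<bullet> h \<bullet> l' \<bullet> ?r \<triangleright>*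
        cons_tm \<bullet> (pair_tm \<bullet> h \<bullet> (h \<bullet> V \<bullet> P)) \<bullet> ?r"
      using cw reds_beta5[of V P h l' ?r
          "cons_tm \<bullet> (pair_tm \<bullet> Var 2 \<bullet> (Var 2 \<bullet> Var 4 \<bullet> Var 3)) \<bullet> Var 0"]
      by (simp add: paired_tm_def[simplified, symmetric])
    ultimately show ?case using cw l by (auto intro: rep_reds rtranclp_trans)
  qed
  then have "rep (p f k (map (\<lambda>x. (x, rec_tm v p x)) ts))
      (P \<bullet> a \<bullet> b \<bullet> (l \<bullet> nil_tm \<bullet> (paired_tm \<bullet> V \<bullet> P)))"
    using p a rep_app[OF rep_app[OF rep_app]] by blast
  then show ?case using t v p Op.prems by (auto simp: rep_closed_wf intro: rep_reds)
qed

lemma computable_rec_tm: "computable rec_tm"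
proof (rule computableI)
  show "rep rec_tm (LAM (LAM (LAM (Var 0 \<bullet> Var 2 \<bullet> Var 1))))"
    by (rule rep_fun3I) (auto simp: rep_closed_wf intro!: closed_wf_I rep_rec_tm dest: rep_closed_wf)
qed

definition var_tm :: tm where
  "var_tm = LAM (LAM (LAM (Var 1 \<bullet> Var 2)))"

definition op_tm :: tm where
  "op_tm = LAM (LAM (LAM (LAM (LAM
    (Var 0 \<bullet> Var 4 \<bullet> Var 3 \<bullet> (Var 2 \<bullet> nil_tm \<bullet> (paired_tm \<bullet> Var 1 \<bullet> Var 0)))))))"

lemma closed_wf_tm_data [simp]: "closed_wf var_tm" "closed_wf op_tm"
  by (auto simp: var_tm_def op_tm_def intro!: closed_wf_I)

lemma rep_Var: "rep Var var_tm"
proof (rule rep_funI)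
  fix i t assume i: "rep (i::nat) t"
  then have "var_tm \<bullet> t \<bullet> v \<bullet> p \<triangleright>* v \<bullet> t" if "closed_wf v" "closed_wf p" for v p
    using reds_beta3[of t v p "Var 1 \<bullet> Var 2"] that
    by (simp add: var_tm_def rep_closed_wf)
  then show "rep (Var i) (var_tm \<bullet> t)"
    using i rep_closed_wf[OF i] by (auto simp: rep_tm_def)
qed simp

lemma rep_Op: "rep Op op_tm"
proof (intro rep_funI)
  fix f a k b ts l assume *: "rep (f::opcode) a" "rep (k::nat) b" "rep (ts::tm list) l"
  then have "op_tm \<bullet> a \<bullet> b \<bullet> l \<bullet> v \<bullet> p \<triangleright>* p \<bullet> a \<bullet> b \<bullet> (l \<bullet> nil_tm \<bullet> (paired_tm \<bullet> v \<bullet> p))"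
    if "closed_wf v" "closed_wf p" for v p
    using reds_beta5[of a b l v p
        "Var 0 \<bullet> Var 4 \<bullet> Var 3 \<bullet> (Var 2 \<bullet> nil_tm \<bullet> (paired_tm \<bullet> Var 1 \<bullet> Var 0))"] that
    by (simp add: op_tm_def rep_closed_wf)
  then show "rep (Op f k ts) (op_tm \<bullet> a \<bullet> b \<bullet> l)"
    using * * [THEN rep_closed_wf] unfolding rep_tm_def rep_tm_at.simps rep_list_def
    by (intro conjI exI[of _ a] exI[of _ b] exI[of _ l]) simp_all
qed (auto simp: rep_closed_wf)

text \<open>
  The collection decomposes a goal \<open>computable (\<lambda>p. e)\<close> along the structure of \<open>e\<close>. The environment \<open>p\<close>
  grows to the left-nested tuple of \<open>p\<close> and the bound variables that were passed, which accounts for the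
  chains of projections below. Constant subexpressions lead to goals without environment; rules like
  \<open>computable_Pair_const\<close> make sure that these can always be solved, so that the search never has to backtrack.
\<close>

named_theorems computable_intros

lemmas [computable_intros] = computable_id computable_const computable_curry
  computable_unary[OF computable_fst] computable_unary[OF computable_snd]
  computable_binary[OF computable_Pair] computable_ternary[OF computable_If] computable_bool

lemma computable_Pair_const [computable_intros]:
  "computable x \<Longrightarrow> computable y \<Longrightarrow> computable (x, y)"
  by (blast intro: computable_apply computable_Pair)

text \<open>
  Functions enter the environment as recursive results, which come as second components.
\<close>

lemma computable_snd_app [computable_intros]:
  "computable r \<Longrightarrow> computable a \<Longrightarrow> computable (\<lambda>q. snd (r q) (a q))"
  by (rule computable_app[OF computable_unary[OF computable_snd]])

lemma computable_snd_app2 [computable_intros]: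
  "computable r \<Longrightarrow> computable a \<Longrightarrow> computable b \<Longrightarrow> computable (\<lambda>q. snd (r q) (a q) (b q))"
  by (rule computable_app[OF computable_snd_app])

lemma computable_curry2:
  "computable (\<lambda>q. f (fst (fst q)) (snd (fst q)) (snd q)) \<Longrightarrow> computable f"
  by (intro computable_curry)

lemma computable_curry3:
  "computable (\<lambda>q. f (fst (fst (fst q))) (snd (fst (fst q))) (snd (fst q)) (snd q)) \<Longrightarrow> computable f"
  by (intro computable_curry)

lemma computable_fun_arg:
  "computable (\<lambda>q. f (fst q) (snd q)) \<Longrightarrow> computable a \<Longrightarrow> computable b \<Longrightarrow> computable (\<lambda>p. f (a p) (b p))"
  by (rule computable_binary[OF computable_curry])

lemma computable_fun_arg2:
  "computable (\<lambda>q. f (fst (fst q)) (snd (fst q)) (snd q)) \<Longrightarrow>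
    computable a \<Longrightarrow> computable b \<Longrightarrow> computable c \<Longrightarrow> computable (\<lambda>p. f (a p) (b p) (c p))"
  by (rule computable_ternary[OF computable_curry2])

lemma computable_fun_arg3:
  "computable (\<lambda>q. f (fst (fst (fst q))) (snd (fst (fst q))) (snd (fst q)) (snd q)) \<Longrightarrow>
    computable a \<Longrightarrow> computable b \<Longrightarrow> computable c \<Longrightarrow> computable d \<Longrightarrow>
    computable (\<lambda>p. f (a p) (b p) (c p) (d p))"
  by (rule computable_app[OF computable_ternary[OF computable_curry3]])

section \<open>Computable operations on truth values, numbers and lists\<close>

lemma computable_conj [computable_intros]:
  "computable a \<Longrightarrow> computable b \<Longrightarrow> computable (\<lambda>p. a p \<and> b p)"
proof -
  assume "computable a" "computable b"
  then have "computable (\<lambda>p. if a p then b p else False)" by (intro computable_intros)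
  moreover have "(\<lambda>p. if a p then b p else False) = (\<lambda>p. a p \<and> b p)" by auto
  ultimately show ?thesis by simp
qed

lemma computable_not [computable_intros]:
  "computable a \<Longrightarrow> computable (\<lambda>p. \<not> a p)"
proof -
  assume "computable a"
  then have "computable (\<lambda>p. if a p then False else True)" by (intro computable_intros)
  moreover have "(\<lambda>p. if a p then False else True) = (\<lambda>p. \<not> a p)" by auto
  ultimately show ?thesis by simp
qed

lemma computable_disj [computable_intros]:
  "computable a \<Longrightarrow> computable b \<Longrightarrow> computable (\<lambda>p. a p \<or> b p)"
proof -
  assume "computable a" "computable b"
  then have "computable (\<lambda>p. \<not> (\<not> a p \<and> \<not> b p))" by (intro computable_intros)
  then show ?thesis by simp
qed

lemma computable_0 [computable_intros]: "computable (0::nat)"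
  using rep_0 by (rule computableI)

lemma computable_Suc [computable_intros]:
  "computable a \<Longrightarrow> computable (\<lambda>p. Suc (a p))"
  by (rule computable_unary[OF computableI[OF rep_Suc]])

lemma computable_rec_nat' [computable_intros]:
  "computable z \<Longrightarrow> computable (\<lambda>q. s (fst (fst q)) (snd (fst q)) (snd q)) \<Longrightarrow> computable n \<Longrightarrow>
    computable (\<lambda>p. rec_nat (z p) (s p) (n p))"
  by (intro computable_ternary[OF computable_rec_nat] computable_curry2[of s])

lemma computable_case_nat [computable_intros]:
  assumes "computable z" "computable (\<lambda>q. s (fst q) (snd q))" "computable n"
  shows "computable (\<lambda>p. case_nat (z p) (s p) (n p))"
proof -
  have "computable (\<lambda>p. rec_nat (z p) (\<lambda>m _. s p m) (n p))"
    by (intro computable_intros computable_fun_arg[OF assms(2)] assms(1,3))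
  moreover have "rec_nat x (\<lambda>m _. f m) i = case_nat x f i" for x :: 'b and f i by (cases i) auto
  ultimately show ?thesis by simp
qed

lemma computable_nat [computable_intros]: "computable (n::nat)"
  by (induction n) (auto intro: computable_0 computable_apply computableI[OF rep_Suc])

lemma computable_add [computable_intros]:
  "computable m \<Longrightarrow> computable n \<Longrightarrow> computable (\<lambda>p. m p + n p :: nat)"
proof -
  assume "computable m" "computable n"
  then have "computable (\<lambda>p. rec_nat (n p) (\<lambda>_ r. Suc r) (m p))" by (intro computable_intros)
  moreover have "rec_nat j (\<lambda>_ r. Suc r) i = i + j" for i j by (induction i) auto
  ultimately show ?thesis by simp
qed

lemma computable_diff [computable_intros]:
  "computable m \<Longrightarrow> computable n \<Longrightarrow> computable (\<lambda>p. m p - n p :: nat)"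
proof -
  assume "computable m" "computable n"
  then have "computable (\<lambda>p. rec_nat (m p) (\<lambda>_ r. case r of 0 \<Rightarrow> 0 | Suc x \<Rightarrow> x) (n p))" by (intro computable_intros)
  moreover have "rec_nat j (\<lambda>_ r. case r of 0 \<Rightarrow> 0 | Suc x \<Rightarrow> x) i = j - i" for i j
    by (induction i) (auto split: nat.split)
  ultimately show ?thesis by simp
qed

lemma computable_less [computable_intros]:
  "computable m \<Longrightarrow> computable n \<Longrightarrow> computable (\<lambda>p. (m p :: nat) < n p)"
proof -
  assume "computable m" "computable n"
  then have "computable (\<lambda>p. case n p - m p of 0 \<Rightarrow> False | Suc _ \<Rightarrow> True)" by (intro computable_intros)
  moreover have "(case j - i of 0 \<Rightarrow> False | Suc _ \<Rightarrow> True) \<longleftrightarrow> i < j" for i j :: nat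
    by (auto split: nat.split)
  ultimately show ?thesis by simp
qed

lemma computable_nat_eq [computable_intros]:
  "computable m \<Longrightarrow> computable n \<Longrightarrow> computable (\<lambda>p. (m p :: nat) = n p)"
proof -
  assume "computable m" "computable n"
  then have "computable (\<lambda>p. \<not> m p < n p \<and> \<not> n p < m p)" by (intro computable_intros)
  moreover have "\<not> i < j \<and> \<not> j < i \<longleftrightarrow> i = j" for i j :: nat by auto
  ultimately show ?thesis by simp
qed

lemma computable_Nil [computable_intros]: "computable []"
  using rep_Nil by (rule computableI)

lemma computable_Cons [computable_intros]:
  "computable x \<Longrightarrow> computable l \<Longrightarrow> computable (\<lambda>p. x p # l p)"
  by (rule computable_binary[OF computableI[OF rep_Cons]])

lemma computable_Cons_const [computable_intros]:
  "computable x \<Longrightarrow> computable xs \<Longrightarrow> computable (x # xs)"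
  by (blast intro: computable_apply computableI[OF rep_Cons])

lemma computable_rec_list' [computable_intros]:
  "computable z \<Longrightarrow> computable (\<lambda>q. c (fst (fst (fst q))) (snd (fst (fst q))) (snd (fst q)) (snd q)) \<Longrightarrow>
    computable l \<Longrightarrow> computable (\<lambda>p. rec_list (z p) (c p) (l p))"
  by (intro computable_ternary[OF computable_rec_list] computable_curry3[of c])

lemma computable_case_list [computable_intros]:
  assumes "computable z" "computable (\<lambda>q. c (fst (fst q)) (snd (fst q)) (snd q))" "computable l"
  shows "computable (\<lambda>p. case_list (z p) (c p) (l p))"
proof -
  have "computable (\<lambda>p. rec_list (z p) (\<lambda>x xs _. c p x xs) (l p))"
    by (intro computable_intros computable_fun_arg2[OF assms(2)] assms(1,3))
  moreover have "rec_list x (\<lambda>y ys _. f y ys) l = case_list x f l" for x :: 'b and f and l :: "'c list"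
    by (cases l) auto
  ultimately show ?thesis by simp
qed

lemma computable_map [computable_intros]:
  assumes "computable (\<lambda>q. f (fst q) (snd q))" "computable l"
  shows "computable (\<lambda>p. map (f p) (l p))"
proof -
  have "computable (\<lambda>p. rec_list [] (\<lambda>x _ r. f p x # r) (l p))"
    by (intro computable_intros computable_fun_arg[OF assms(1)] assms(2))
  moreover have "rec_list [] (\<lambda>x _ r. g x # r) l = map g l" for g :: "'b \<Rightarrow> 'c" and l by (induction l) auto
  ultimately show ?thesis by simp
qed

lemma computable_list_all [computable_intros]:
  assumes "computable (\<lambda>q. f (fst q) (snd q))" "computable l"
  shows "computable (\<lambda>p. list_all (f p) (l p))"
proof -
  have "computable (\<lambda>p. rec_list True (\<lambda>x _ r. f p x \<and> r) (l p))"
    by (intro computable_intros computable_fun_arg[OF assms(1)] assms(2))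
  moreover have "rec_list True (\<lambda>x _ r. g x \<and> r) l = list_all g l" for g :: "'b \<Rightarrow> bool" and l
    by (induction l) auto
  ultimately show ?thesis by simp
qed

lemma computable_list_ex [computable_intros]:
  assumes "computable (\<lambda>q. f (fst q) (snd q))" "computable l"
  shows "computable (\<lambda>p. list_ex (f p) (l p))"
proof -
  have "computable (\<lambda>p. rec_list False (\<lambda>x _ r. f p x \<or> r) (l p))"
    by (intro computable_intros computable_fun_arg[OF assms(1)] assms(2))
  moreover have "rec_list False (\<lambda>x _ r. g x \<or> r) l = list_ex g l" for g :: "'b \<Rightarrow> bool" and l
    by (induction l) auto
  ultimately show ?thesis by simp
qed

lemma computable_append [computable_intros]:
  assumes "computable l" "computable m"
  shows "computable (\<lambda>p. l p @ m p)"
proof -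
  have "computable (\<lambda>p. rec_list (m p) (\<lambda>x _ r. x # r) (l p))" by (intro computable_intros assms)
  moreover have "rec_list m (\<lambda>x _ r. x # r) l = l @ m" for l m :: "'b list" by (induction l) auto
  ultimately show ?thesis by simp
qed

lemma computable_bind [computable_intros]:
  assumes "computable (\<lambda>q. f (fst q) (snd q))" "computable l"
  shows "computable (\<lambda>p. List.bind (l p) (f p))"
proof -
  have "computable (\<lambda>p. rec_list [] (\<lambda>x _ r. f p x @ r) (l p))"
    by (intro computable_intros computable_fun_arg[OF assms(1)] assms(2))
  moreover have "rec_list [] (\<lambda>x _ r. g x @ r) l = List.bind l g" for g :: "'b \<Rightarrow> 'c list" and l
    by (induction l) (auto simp: List.bind_def)
  ultimately show ?thesis by simp
qed

lemma computable_length [computable_intros]: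
  assumes "computable l" shows "computable (\<lambda>p. length (l p))"
proof -
  have "computable (\<lambda>p. rec_list 0 (\<lambda>_ _ r. Suc r) (l p))" by (intro computable_intros assms)
  moreover have "rec_list 0 (\<lambda>_ _ r. Suc r) l = length l" for l :: "'b list" by (induction l) auto
  ultimately show ?thesis by simp
qed

lemma computable_null [computable_intros]:
  assumes "computable l" shows "computable (\<lambda>p. l p = [])"
proof -
  have "computable (\<lambda>p. case l p of [] \<Rightarrow> True | _ # _ \<Rightarrow> False)" by (intro computable_intros assms)
  moreover have "(case l of [] \<Rightarrow> True | _ # _ \<Rightarrow> False) \<longleftrightarrow> l = []" for l :: "'b list" by (cases l) auto
  ultimately show ?thesis by simp
qed

section \<open>Computable operations on operators and terms\<close>

text \<open>
  Operators are represented by their index, so the identity represents this function and its inverse.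
\<close>

lemma computable_op_index [computable_intros]:
  assumes "computable f" shows "computable (\<lambda>p. op_index (f p))"
proof -
  have "rep op_index (LAM (Var 0))"
    by (rule rep_fun1I) (auto intro!: closed_wf_I simp: rep_opcode_def)
  then show ?thesis using assms by (blast intro: computable_unary computableI)
qed

definition op_of :: "nat \<Rightarrow> opcode" where
  "op_of = inv op_index"

lemma inj_op_index: "inj op_index"
proof (rule injI)
  fix f g assume "op_index f = op_index g"
  then show "f = g" by (cases f; cases g) auto
qed

lemma op_index_surj: "\<exists>f. op_index f = n"
proof (cases "n < 10")
  case True
  then have "n = 0 \<or> n = 1 \<or> n = 2 \<or> n = 3 \<or> n = 4 \<or> n = 5 \<or> n = 6 \<or> n = 7 \<or> n = 8 \<or> n = 9"
    by auto
  then show ?thesis using op_index.simps by metis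
next
  case False
  then have "op_index (OForeign (n - 10)) = n" by simp
  then show ?thesis by blast
qed

lemma op_index_op_of: "op_index (op_of n) = n"
  using op_index_surj by (metis op_of_def f_inv_into_f rangeI)

lemma op_of_op_index: "op_of (op_index f) = f"
  by (simp add: op_of_def inj_op_index)

lemma computable_op_of [computable_intros]:
  assumes "computable n" shows "computable (\<lambda>p. op_of (n p))"
proof -
  have "rep op_of (LAM (Var 0))"
    by (rule rep_fun1I) (auto intro!: closed_wf_I simp: rep_opcode_def op_index_op_of)
  then show ?thesis using assms by (blast intro: computable_unary computableI)
qed

lemma computable_opcode [computable_intros]: "computable (f::opcode)"
  using computable_nat[of "op_index f"] by (auto simp: computable_def rep_opcode_def)

lemma computable_op_eq [computable_intros]:
  "computable f \<Longrightarrow> computable g \<Longrightarrow> computable (\<lambda>p. (f p :: opcode) = g p)"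
proof -
  assume "computable f" "computable g"
  then have "computable (\<lambda>p. op_index (f p) = op_index (g p))" by (intro computable_intros)
  then show ?thesis by (simp add: inj_eq[OF inj_op_index])
qed

lemma computable_Var [computable_intros]:
  "computable i \<Longrightarrow> computable (\<lambda>p. Var (i p))"
  by (rule computable_unary[OF computableI[OF rep_Var]])

lemma computable_Op [computable_intros]:
  "computable f \<Longrightarrow> computable k \<Longrightarrow> computable l \<Longrightarrow> computable (\<lambda>p. Op (f p) (k p) (l p))"
  by (rule computable_ternary[OF computableI[OF rep_Op]])

lemma computable_rec_tm' [computable_intros]:
  "computable (\<lambda>q. v (fst q) (snd q)) \<Longrightarrow>
    computable (\<lambda>q. c (fst (fst (fst q))) (snd (fst (fst q))) (snd (fst q)) (snd q)) \<Longrightarrow>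
    computable t \<Longrightarrow> computable (\<lambda>p. rec_tm (v p) (c p) (t p))"
  by (intro computable_ternary[OF computable_rec_tm] computable_curry3[of c] computable_curry[of v])

lemma computable_case_tm [computable_intros]:
  assumes "computable (\<lambda>q. v (fst q) (snd q))"
    "computable (\<lambda>q. c (fst (fst (fst q))) (snd (fst (fst q))) (snd (fst q)) (snd q))" "computable t"
  shows "computable (\<lambda>p. case_tm (v p) (c p) (t p))"
proof -
  have "computable (\<lambda>p. rec_tm (v p) (\<lambda>f k rs. c p f k (map fst rs)) (t p))"
    by (intro computable_intros computable_fun_arg3[OF assms(2)] computable_fun_arg[OF assms(1)] assms(3))
  moreover have "rec_tm x (\<lambda>f k rs. g f k (map fst rs)) t = case_tm x g t" for x :: "nat \<Rightarrow> 'b" and g t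
    by (cases t) (auto simp: comp_def)
  ultimately show ?thesis by simp
qed


lemma computable_rec_tm_app [computable_intros]:
  "computable (\<lambda>q. v (fst q) (snd q)) \<Longrightarrow>
    computable (\<lambda>q. c (fst (fst (fst q))) (snd (fst (fst q))) (snd (fst q)) (snd q)) \<Longrightarrow>
    computable t \<Longrightarrow> computable a \<Longrightarrow> computable (\<lambda>p. rec_tm (v p) (c p) (t p) (a p))"
  by (rule computable_app[OF computable_rec_tm'])

lemma computable_rec_tm_app2 [computable_intros]:
  "computable (\<lambda>q. v (fst q) (snd q)) \<Longrightarrow>
    computable (\<lambda>q. c (fst (fst (fst q))) (snd (fst (fst q))) (snd (fst q)) (snd q)) \<Longrightarrow>
    computable t \<Longrightarrow> computable a \<Longrightarrow> computable b \<Longrightarrow>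
    computable (\<lambda>p. rec_tm (v p) (c p) (t p) (a p) (b p))"
  by (rule computable_app[OF computable_rec_tm_app])

lemma computable_rec_list_app [computable_intros]:
  "computable z \<Longrightarrow> computable (\<lambda>q. c (fst (fst (fst q))) (snd (fst (fst q))) (snd (fst q)) (snd q)) \<Longrightarrow>
    computable l \<Longrightarrow> computable a \<Longrightarrow> computable (\<lambda>p. rec_list (z p) (c p) (l p) (a p))"
  by (rule computable_app[OF computable_rec_list'])

text \<open>
  The recursion equations of the syntactic operations in terms of \<open>rec_tm\<close>. Arguments that change
  under binders make the result of the recursion a function; \<open>snd r\<close> is the recursive result for the
  argument \<open>fst r\<close>.
\<close>

lemma shift_rec:
  "shift d c t = rec_tm (\<lambda>i c. Var (if i < c then i else i + d))
     (\<lambda>f k rs c. Op f k (map (\<lambda>r. snd r (c + k)) rs)) t c"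
  by (induction t arbitrary: c) auto

lemma computable_shift [computable_intros]:
  assumes "computable a" "computable b" "computable c"
  shows "computable (\<lambda>p. shift (a p) (b p) (c p))"
proof -
  have "computable shift"
    by (rule computable_curry2, unfold shift_rec) (intro computable_intros)
  then show ?thesis using assms by (rule computable_ternary)
qed

lemma inst_at_rec:
  "inst_at c s t = rec_tm (\<lambda>j c. if j < c then Var j else if j = c then shift c 0 s else Var (j - 1))
     (\<lambda>f k rs c. Op f k (map (\<lambda>r. snd r (c + k)) rs)) t c"
  by (induction t arbitrary: c) auto

lemma computable_inst_at [computable_intros]:
  assumes "computable a" "computable b" "computable c"
  shows "computable (\<lambda>p. inst_at (a p) (b p) (c p))"
proof -
  have "computable inst_at"
    by (rule computable_curry2, unfold inst_at_rec) (intro computable_intros)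
  then show ?thesis using assms by (rule computable_ternary)
qed

lemma subst_rec:
  "subst i s t = rec_tm (\<lambda>j i s. if j = i then s else Var j)
     (\<lambda>f k rs i s. Op f k (map (\<lambda>r. snd r (i + k) (shift k 0 s)) rs)) t i s"
  by (induction t arbitrary: i s) auto

lemma computable_subst [computable_intros]:
  "computable i \<Longrightarrow> computable s \<Longrightarrow> computable t \<Longrightarrow> computable (\<lambda>p. subst (i p) (s p) (t p))"
  unfolding subst_rec by (intro computable_intros)

definition sig_ok :: "opcode \<Rightarrow> nat \<Rightarrow> nat \<Rightarrow> bool" where
  "sig_ok f k n \<longleftrightarrow>
    (if f = OBot \<or> f = OZero \<or> f = ORec \<or> f = OAll then k = 0 \<and> n = 0
     else if f = OSuc \<or> f = ONeg then k = 0 \<and> n = 1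
     else if f = OLam then k = 1 \<and> n = 1
     else if f = OEq \<or> f = OOr \<or> f = OApp then k = 0 \<and> n = 2 else False)"

lemma sig_ok_iff: "sig_ok f k n \<longleftrightarrow> op_sig f = Some (k, n)"
  by (cases f) (auto simp: sig_ok_def)

lemma wf_tm_rec:
  "wf_tm t = rec_tm (\<lambda>_. True) (\<lambda>f k rs. sig_ok f k (length rs) \<and> list_all snd rs) t"
  by (induction t) (auto simp: sig_ok_iff list_all_iff)

lemma computable_wf_tm [computable_intros]:
  "computable t \<Longrightarrow> computable (\<lambda>p. wf_tm (t p))"
  unfolding wf_tm_rec sig_ok_def by (intro computable_intros)

lemma fv_rec:
  "i \<in> fv t \<longleftrightarrow> rec_tm (\<lambda>j i. j = i) (\<lambda>f k rs i. list_ex (\<lambda>r. snd r (i + k)) rs) t i"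
  by (induction t arbitrary: i) (auto simp: list_ex_iff)

lemma computable_fv [computable_intros]:
  "computable i \<Longrightarrow> computable t \<Longrightarrow> computable (\<lambda>p. i p \<in> fv (t p))"
  unfolding fv_rec by (intro computable_intros)

lemma num_rec: "num n = rec_nat ZERO (\<lambda>_ r. SUC r) n"
  by (induction n) auto

lemma computable_num [computable_intros]:
  "computable n \<Longrightarrow> computable (\<lambda>p. num (n p))"
  unfolding num_rec by (intro computable_intros)

definition tm_eq :: "tm \<Rightarrow> tm \<Rightarrow> bool" where
  "tm_eq t u = rec_tm (\<lambda>i u. case_tm (\<lambda>j. i = j) (\<lambda>_ _ _. False) u)
     (\<lambda>f k rs u. case_tm (\<lambda>_. False) (\<lambda>g l us. f = g \<and> k = l \<and>
       rec_list (\<lambda>us. us = []) (\<lambda>r _ ih us. case_list False (\<lambda>u us. snd r u \<and> ih us) us) rs us) u) t u"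

lemma tm_eq_iff: "tm_eq t u \<longleftrightarrow> t = u"
proof (induction t arbitrary: u)
  case (Var i)
  then show ?case by (cases u) (auto simp: tm_eq_def)
next
  case (Op f k ts)
  let ?r = "rec_list (\<lambda>us. us = []) (\<lambda>r _ ih us. case_list False (\<lambda>u us. snd r u \<and> ih us) us)"
  have "?r (map (\<lambda>t. (t, tm_eq t)) ts) us \<longleftrightarrow> ts = us" for us
    using Op.IH by (induction ts arbitrary: us) (auto split: list.split)
  then show ?case by (cases u) (auto simp: tm_eq_def[abs_def])
qed

lemma computable_tm_eq [computable_intros]:
  "computable t \<Longrightarrow> computable u \<Longrightarrow> computable (\<lambda>p. (t p :: tm) = u p)"
  unfolding tm_eq_iff[symmetric] tm_eq_def by (intro computable_intros)

section \<open>Quotation\<close>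

definition quote_nat :: "nat \<Rightarrow> tm" where
  "quote_nat n = rec_nat nil_tm (\<lambda>_ r. suc_tm \<bullet> r) n"

text \<open>
  The canonical representation of a term. It is itself computable, which is what the diagonal argument
  needs: a term can compute the representation of a term from a representation of that term.
\<close>

definition quote :: "tm \<Rightarrow> tm" where
  "quote t = rec_tm (\<lambda>i. var_tm \<bullet> quote_nat i)
     (\<lambda>f k rs. op_tm \<bullet> quote_nat (op_index f) \<bullet> quote_nat k \<bullet>
       rec_list nil_tm (\<lambda>r _ l. cons_tm \<bullet> snd r \<bullet> l) rs) t"

lemma rep_quote_nat: "rep n (quote_nat n)"
  by (induction n) (auto simp: quote_nat_def intro: rep_0 rep_app[OF rep_Suc])

lemma rep_quote: "rep t (quote t)"
proof (induction t)
  case (Var i)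
  then show ?case using rep_app[OF rep_Var rep_quote_nat] by (simp add: quote_def)
next
  case (Op f k ts)
  have "rep ts (rec_list nil_tm (\<lambda>r _ l. cons_tm \<bullet> snd r \<bullet> l) (map (\<lambda>t. (t, quote t)) ts))"
    using Op.IH by (induction ts) (auto intro: rep_Nil rep_app[OF rep_app[OF rep_Cons]])
  then have "rep (Op f k ts) (op_tm \<bullet> quote_nat (op_index f) \<bullet> quote_nat k \<bullet>
      rec_list nil_tm (\<lambda>r _ l. cons_tm \<bullet> snd r \<bullet> l) (map (\<lambda>t. (t, quote t)) ts))"
    using rep_quote_nat[of "op_index f"] rep_quote_nat[of k]
    by (intro rep_app[OF rep_app[OF rep_app[OF rep_Op]]]) (auto simp: rep_opcode_def)
  then show ?case by (simp add: quote_def[abs_def])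
qed

lemma computable_tm [computable_intros]: "computable (t::tm)"
  using rep_quote by (rule computableI)

lemma computable_quote [computable_intros]:
  "computable t \<Longrightarrow> computable (\<lambda>p. quote (t p))"
  unfolding quote_def quote_nat_def by (intro computable_intros)

section \<open>Enumerating lists of terms\<close>

definition below :: "nat \<Rightarrow> nat list" where
  "below n = rec_nat [] (\<lambda>m r. m # r) n"

lemma set_below [simp]: "set (below n) = {..<n}"
  by (induction n) (auto simp: below_def lessThan_Suc)

text \<open>
  One growing list of lists enumerates everything: a term is added in front of a known list as soon as
  its arguments form a known list and its indices are below the round number.
\<close>

definition tm_lists :: "nat \<Rightarrow> tm list list" where
  "tm_lists n = rec_nat [[]] (\<lambda>n L. L @
     List.bind L (\<lambda>l. map (\<lambda>i. Var i # l) (below n) @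
       List.bind L (\<lambda>ts. List.bind (below n) (\<lambda>f. map (\<lambda>k. Op (op_of f) k ts # l) (below n))))) n"

lemma computable_below [computable_intros]:
  "computable n \<Longrightarrow> computable (\<lambda>p. below (n p))"
  unfolding below_def by (intro computable_intros)

lemma computable_tm_lists [computable_intros]:
  "computable n \<Longrightarrow> computable (\<lambda>p. tm_lists (n p))"
  unfolding tm_lists_def by (intro computable_intros)

lemma tm_lists_0 [simp]: "tm_lists 0 = [[]]"
  by (simp add: tm_lists_def)

lemma tm_lists_Suc: "set (tm_lists (Suc n)) = set (tm_lists n) \<union>
    {Var i # l |i l. i < n \<and> l \<in> set (tm_lists n)} \<union>
    {Op (op_of f) k ts # l |f k ts l. f < n \<and> k < n \<and> ts \<in> set (tm_lists n) \<and> l \<in> set (tm_lists n)}"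
proof -
  have "tm_lists (Suc n) = tm_lists n @ List.bind (tm_lists n) (\<lambda>l. map (\<lambda>i. Var i # l) (below n) @
      List.bind (tm_lists n) (\<lambda>ts. List.bind (below n) (\<lambda>f. map (\<lambda>k. Op (op_of f) k ts # l) (below n))))"
    by (simp add: tm_lists_def)
  then show ?thesis by (simp add: image_def set_list_bind) blast
qed

lemma tm_lists_mono: "m \<le> n \<Longrightarrow> set (tm_lists m) \<subseteq> set (tm_lists n)"
  by (rule lift_Suc_mono_le[of "\<lambda>n. set (tm_lists n)"]) (auto simp: tm_lists_Suc)

lemma tm_lists_Cons:
  "l \<in> set (tm_lists n) \<Longrightarrow> \<exists>m. t # l \<in> set (tm_lists m)"
proof (induction t arbitrary: l n)
  case (Var i)
  then have "l \<in> set (tm_lists (max n (Suc i)))" using tm_lists_mono[of n "max n (Suc i)"] by auto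
  then have "Var i # l \<in> set (tm_lists (Suc (max n (Suc i))))" by (auto simp: tm_lists_Suc)
  then show ?case by blast
next
  case (Op f k ts)
  have "\<exists>m. ts \<in> set (tm_lists m)"
    using Op.IH
  proof (induction ts)
    case Nil
    have "[] \<in> set (tm_lists 0)" by simp
    then show ?case by blast
  next
    case (Cons t ts)
    then show ?case by (metis list.set_intros)
  qed
  then obtain m where m: "ts \<in> set (tm_lists m)" by blast
  let ?N = "Max {m, n, Suc (op_index f), Suc k}"
  have le: "m \<le> ?N" "n \<le> ?N" "op_index f < ?N" "k < ?N" by (auto simp: Suc_le_eq[symmetric])
  then have "ts \<in> set (tm_lists ?N)" "l \<in> set (tm_lists ?N)"
    using m Op.prems tm_lists_mono by blast+
  then have "Op (op_of (op_index f)) k ts # l \<in> set (tm_lists (Suc ?N))"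
    using le unfolding tm_lists_Suc by blast
  then show ?case unfolding op_of_op_index by blast
qed

lemma tm_lists_exhaustive: "\<exists>n. l \<in> set (tm_lists n)"
proof (induction l)
  case Nil
  have "[] \<in> set (tm_lists 0)" by simp
  then show ?case by blast
qed (use tm_lists_Cons in blast)

section \<open>Rule instances as data\<close>

text \<open>
  Contexts are represented by lists, and sequents with the same set of hypotheses are identified later.
\<close>

type_synonym jdg = "tm list \<times> tm"

fun seq :: "jdg \<Rightarrow> sequent" where
  "seq (G, c) = (fset_of_list G \<turnstile> c)"

text \<open>
  The arguments are listed from the outermost to the innermost, so that the last application comes
  first and a recursion on lists suffices.
\<close>

definition apps :: "tm \<Rightarrow> tm list \<Rightarrow> tm" where
  "apps t us = rec_list t (\<lambda>u _ r. r \<bullet> u) us"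

lemma apps_simps [simp]: "apps t [] = t" "apps t (u # us) = apps t us \<bullet> u"
  by (simp_all add: apps_def)

lemma head_step_apps: "t \<triangleright> t' \<Longrightarrow> apps t us \<triangleright> apps t' us"
  by (induction us) (auto intro: head_step.app)

text \<open>
  Side condition, premises and conclusion. All rules together are described by one finite list that depends
  on a context, a list of terms, three terms and a number; a rule uses as many of them as it has
  metavariables. Instances with a false side condition are listed and skipped later.
\<close>

type_synonym rule_instance = "bool \<times> jdg list \<times> jdg"

definition structural_rules :: "tm list \<Rightarrow> tm \<Rightarrow> tm \<Rightarrow> nat \<Rightarrow> rule_instance list" where
  "structural_rules G a c v = [
    (wf_tm c, [], (c # G, c)),
    (True, [(G, c)], (a # G, c)),
    (True, [(G, a), (a # G, c)], (G, c)),
    (list_all wf_tm G \<and> wf_tm c \<and> wf_tm a, [(G, c)], (map (subst v a) G, subst v a c))]"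

definition logical_rules :: "tm list \<Rightarrow> tm \<Rightarrow> tm \<Rightarrow> tm \<Rightarrow> rule_instance list" where
  "logical_rules G a b c = [
    (True, [(G, a)], (G, a \<^bold>= num 1)),
    (True, [(G, a \<^bold>= num 1)], (G, a)),
    (True, [(G, NEG a)], (G, a \<^bold>= num 0)),
    (True, [(G, a \<^bold>= num 0)], (G, NEG a)),
    (wf_tm c, [(G, NEG a), (G, a)], (G, c)),
    (True, [(G, a)], (G, NEG (NEG a))),
    (True, [(G, NEG (NEG a))], (G, a)),
    (wf_tm b, [(G, a)], (G, a \<^bold>\<or> b)),
    (wf_tm a, [(G, b)], (G, a \<^bold>\<or> b)),
    (True, [(G, NEG a), (G, NEG b)], (G, NEG (a \<^bold>\<or> b))),
    (True, [(G, a \<^bold>\<or> b), (a # G, c), (b # G, c)], (G, c)),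
    (True, [(G, NEG (a \<^bold>\<or> b))], (G, NEG a)),
    (True, [(G, NEG (a \<^bold>\<or> b))], (G, NEG b))]"

definition equality_rules :: "tm list \<Rightarrow> tm \<Rightarrow> tm \<Rightarrow> tm \<Rightarrow> nat \<Rightarrow> rule_instance list" where
  "equality_rules G a b c v = [
    (True, [(G, isN a)], (G, isN a)),
    (True, [(G, a \<^bold>= b)], (G, b \<^bold>= a)),
    (wf_tm c, [(G, a \<^bold>= b), (G, subst v a c)], (G, subst v b c)),
    (True, [(G, a \<^bold>\<noteq> b)], (G, b \<^bold>\<noteq> a)),
    (True, [(G, isN a), (G, isN b)], (G, isB (a \<^bold>= b))),
    (True, [(G, isB (a \<^bold>= b))], (G, isN a \<^bold>\<and> isN b))]"

definition nat_rules :: "tm list \<Rightarrow> tm \<Rightarrow> tm \<Rightarrow> tm \<Rightarrow> nat \<Rightarrow> rule_instance list" where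
  "nat_rules G a b c v = [
    (True, [], (G, isN ZERO)),
    (True, [(G, isN a)], (G, isN (SUC a))),
    (True, [(G, isN (SUC a))], (G, isN a)),
    (True, [(G, isN a)], (G, SUC a \<^bold>\<noteq> ZERO)),
    (True, [(G, a \<^bold>\<noteq> b)], (G, SUC a \<^bold>\<noteq> SUC b)),
    (True, [(G, SUC a \<^bold>\<noteq> SUC b)], (G, a \<^bold>\<noteq> b)),
    (True, [(G, SUC a \<^bold>= SUC b)], (G, a \<^bold>= b)),
    (wf_tm c, [(G, isN BOT)], (G, c)),
    (wf_tm c \<and> list_all (\<lambda>x. v \<notin> fv x) G,
      [(G, subst v ZERO c), (isN (Var v) # c # G, subst v (SUC (Var v)) c), (G, isN a)],
      (G, subst v a c)),
    (wf_tm a, [(G, isN c), (G, isN (b \<bullet> c \<bullet> (REC \<bullet> a \<bullet> b \<bullet> c)))],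
      (G, REC \<bullet> a \<bullet> b \<bullet> SUC c \<^bold>= b \<bullet> c \<bullet> (REC \<bullet> a \<bullet> b \<bullet> c)))]"

definition quantifier_rules :: "tm list \<Rightarrow> tm \<Rightarrow> tm \<Rightarrow> rule_instance list" where
  "quantifier_rules G a c = [
    (True, [(isN (Var 0) # map up G, up c \<bullet> Var 0)], (G, FORALL \<bullet> c)),
    (True, [(G, FORALL \<bullet> c), (G, isN a)], (G, c \<bullet> a)),
    (True, [(G, NEG (c \<bullet> a)), (G, isN a)], (G, NEG (FORALL \<bullet> c))),
    (True, [(G, NEG (FORALL \<bullet> a)), (isN (Var 0) # NEG (up a \<bullet> Var 0) # map up G, up c)], (G, c))]"

definition conversions :: "tm list \<Rightarrow> bool \<Rightarrow> tm \<Rightarrow> tm \<Rightarrow> rule_instance list" where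
  "conversions G w t t' = [(w, [(G, t')], (G, t)), (w, [(G, t)], (G, t')), (w, [(G, isN t')], (G, t \<^bold>= t'))]"

text \<open>
  The rule for head steps inside an application only adds further arguments \<open>us\<close> behind one of the
  three reductions.
\<close>

definition conversion_rules :: "tm list \<Rightarrow> tm list \<Rightarrow> tm \<Rightarrow> tm \<Rightarrow> nat \<Rightarrow> rule_instance list" where
  "conversion_rules G us a b v =
    conversions G (wf_tm a) (apps (LAM b \<bullet> a) us) (apps (beta_inst b a) us) @
    conversions G (wf_tm b) (apps (REC \<bullet> a \<bullet> b \<bullet> ZERO) us) (apps a us) @
    conversions G (wf_tm a) (apps (REC \<bullet> a \<bullet> b \<bullet> SUC (num v)) us)
      (apps (b \<bullet> num v \<bullet> (REC \<bullet> a \<bullet> b \<bullet> num v)) us)"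

definition rule_instances :: "tm list \<Rightarrow> tm list \<Rightarrow> tm \<Rightarrow> tm \<Rightarrow> tm \<Rightarrow> nat \<Rightarrow> rule_instance list" where
  "rule_instances G us a b c v =
    structural_rules G a c v @ logical_rules G a b c @ equality_rules G a b c v @
    nat_rules G a b c v @ quantifier_rules G a c @ conversion_rules G us a b v"

lemma fset_of_list_map: "fset_of_list (map f G) = f |`| fset_of_list G"
  by (induction G) auto

lemma wf_ctx_list: "wf_ctx (fset_of_list G) \<longleftrightarrow> list_all wf_tm G"
  by (simp add: list_all_iff fset_of_list.rep_eq)

lemma fv_ctx_list: "i \<notin> fv_ctx (fset_of_list G) \<longleftrightarrow> list_all (\<lambda>x. i \<notin> fv x) G"
  by (simp add: list_all_iff fset_of_list.rep_eq)

lemma head_step_cases: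
  assumes "t \<triangleright> t'"
  obtains (beta) a b us where "t = apps (LAM b \<bullet> a) us" "t' = apps (beta_inst b a) us" "wf_tm a"
  | (rec_zero) a b us where "t = apps (REC \<bullet> a \<bullet> b \<bullet> ZERO) us" "t' = apps a us" "wf_tm b"
  | (rec_suc) a b n us where "t = apps (REC \<bullet> a \<bullet> b \<bullet> SUC (num n)) us"
      "t' = apps (b \<bullet> num n \<bullet> (REC \<bullet> a \<bullet> b \<bullet> num n)) us" "wf_tm a"
proof -
  have "(\<exists>a b us. t = apps (LAM b \<bullet> a) us \<and> t' = apps (beta_inst b a) us \<and> wf_tm a) \<or>
    (\<exists>a b us. t = apps (REC \<bullet> a \<bullet> b \<bullet> ZERO) us \<and> t' = apps a us \<and> wf_tm b) \<or>
    (\<exists>a b n us. t = apps (REC \<bullet> a \<bullet> b \<bullet> SUC (num n)) us \<and>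
      t' = apps (b \<bullet> num n \<bullet> (REC \<bullet> a \<bullet> b \<bullet> num n)) us \<and> wf_tm a)"
    using assms
    by induction (metis apps_simps(1), metis apps_simps(1), metis apps_simps(1), metis apps_simps(2))
  then show thesis using that by blast
qed

lemma conversions_sound:
  assumes "(True, Ps, C) \<in> set (conversions G w t t')" and "w \<Longrightarrow> t \<triangleright> t'"
  shows "rga_rule (map seq Ps) (seq C)"
  using assms by (auto simp: conversions_def intro: conv_expand conv_reduce conv_eq)

lemma rule_instances_sound:
  assumes "(True, Ps, C) \<in> set (rule_instances G us a b c v)"
  shows "rga_rule (map seq Ps) (seq C)"
proof -
  from assms consider "(True, Ps, C) \<in> set (structural_rules G a c v)"
    | "(True, Ps, C) \<in> set (logical_rules G a b c)"
    | "(True, Ps, C) \<in> set (equality_rules G a b c v)"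
    | "(True, Ps, C) \<in> set (nat_rules G a b c v)"
    | "(True, Ps, C) \<in> set (quantifier_rules G a c)"
    | "(True, Ps, C) \<in> set (conversion_rules G us a b v)"
    by (auto simp: rule_instances_def)
  then show ?thesis
  proof cases
    case 1
    then show ?thesis unfolding structural_rules_def
      using rga_rule.substitution[of "fset_of_list G" c a v]
      by (auto simp: fset_of_list_map wf_ctx_list intro: rga_rule.intros)
  next
    case 2
    then show ?thesis unfolding logical_rules_def
      using rga_rule.true_intro[of "fset_of_list G" a] rga_rule.true_elim[of "fset_of_list G" a]
        rga_rule.false_intro[of "fset_of_list G" a] rga_rule.false_elim[of "fset_of_list G" a]
      by (auto intro: rga_rule.intros)
  next
    case 3
    then show ?thesis unfolding equality_rules_def by (auto intro: rga_rule.intros)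
  next
    case 4
    then show ?thesis unfolding nat_rules_def
      using rga_rule.nat_induction[of c v "fset_of_list G" a]
      by (auto simp: fv_ctx_list[simplified] intro: rga_rule.intros)
  next
    case 5
    then show ?thesis unfolding quantifier_rules_def
      by (auto simp: fset_of_list_map intro: rga_rule.intros[simplified])
  next
    case 6
    then show ?thesis unfolding conversion_rules_def
      by (auto elim!: conversions_sound intro!: head_step_apps intro: head_step.intros[simplified])
  qed
qed

definition covers :: "rule_instance list \<Rightarrow> sequent list \<Rightarrow> sequent \<Rightarrow> bool" where
  "covers R Js J \<longleftrightarrow> (\<exists>(w, Ps, C) \<in> set R. w \<and> map seq Ps = Js \<and> seq C = J)"

lemma covers_mono: "covers R Js J \<Longrightarrow> set R \<subseteq> set R' \<Longrightarrow> covers R' Js J"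
  by (auto simp: covers_def)

definition enumerated_rule :: "sequent list \<Rightarrow> sequent \<Rightarrow> bool" where
  "enumerated_rule Js J \<longleftrightarrow> (\<exists>G us a b c v. covers (rule_instances G us a b c v) Js J)"

lemma enumerated_rule_covers: "covers (rule_instances G us a b c v) Js J \<Longrightarrow> enumerated_rule Js J"
  unfolding enumerated_rule_def by blast

lemma enumerated_rule_structural: "covers (structural_rules G a c v) Js J \<Longrightarrow> enumerated_rule Js J"
  by (rule enumerated_rule_covers[of G "[]" a a c v], erule covers_mono) (auto simp: rule_instances_def)

lemma enumerated_rule_logical: "covers (logical_rules G a b c) Js J \<Longrightarrow> enumerated_rule Js J"
  by (rule enumerated_rule_covers[of G "[]" a b c 0], erule covers_mono) (auto simp: rule_instances_def)

lemma enumerated_rule_equality: "covers (equality_rules G a b c v) Js J \<Longrightarrow> enumerated_rule Js J"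
  by (rule enumerated_rule_covers[of G "[]" a b c v], erule covers_mono) (auto simp: rule_instances_def)

lemma enumerated_rule_nat: "covers (nat_rules G a b c v) Js J \<Longrightarrow> enumerated_rule Js J"
  by (rule enumerated_rule_covers[of G "[]" a b c v], erule covers_mono) (auto simp: rule_instances_def)

lemma enumerated_rule_quantifier: "covers (quantifier_rules G a c) Js J \<Longrightarrow> enumerated_rule Js J"
  by (rule enumerated_rule_covers[of G "[]" a a c 0], erule covers_mono) (auto simp: rule_instances_def)

lemma enumerated_rule_conversion: "covers (conversion_rules G us a b v) Js J \<Longrightarrow> enumerated_rule Js J"
  by (rule enumerated_rule_covers[of G us a b a v], erule covers_mono) (auto simp: rule_instances_def)

definition ctx_list :: "tm fset \<Rightarrow> tm list" where
  "ctx_list \<Gamma> = (SOME G. fset_of_list G = \<Gamma>)"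

lemma fset_of_ctx_list [simp]: "fset_of_list (ctx_list \<Gamma>) = \<Gamma>"
  unfolding ctx_list_def by (rule someI_ex) (rule exists_fset_of_list)

lemma ctx_list_props:
  "wf_ctx \<Gamma> \<Longrightarrow> list_all wf_tm (ctx_list \<Gamma>)"
  "i \<notin> fv_ctx \<Gamma> \<Longrightarrow> list_all (\<lambda>x. i \<notin> fv x) (ctx_list \<Gamma>)"
  using wf_ctx_list[of "ctx_list \<Gamma>"] fv_ctx_list[of i "ctx_list \<Gamma>"] by simp_all

lemma head_step_conversions:
  assumes "t \<triangleright> t'"
  obtains us a b v w where "w" "set (conversions G w t t') \<subseteq> set (conversion_rules G us a b v)"
  using assms
proof (cases rule: head_step_cases)
  case (beta a b us)
  show thesis by (rule that[of True us a b 0]) (use beta in \<open>auto simp: conversion_rules_def\<close>)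
next
  case (rec_zero a b us)
  show thesis by (rule that[of True us a b 0]) (use rec_zero in \<open>auto simp: conversion_rules_def\<close>)
next
  case (rec_suc a b n us)
  show thesis by (rule that[of True us a b n]) (use rec_suc in \<open>auto simp: conversion_rules_def\<close>)
qed

text \<open>
  Every rule is found by choosing the parameters of the list as its metavariables. Parameters that do
  not occur in the rule are filled with \<open>ZERO\<close> or \<open>0\<close>.
\<close>

lemma rule_instances_complete:
  assumes "rga_rule Js J" shows "enumerated_rule Js J"
  using assms
proof (cases rule: rga_rule.cases)
  case (hyp c \<Gamma>)
  then show ?thesis
    by (intro enumerated_rule_structural[of "ctx_list \<Gamma>" "ZERO" c 0])
      (simp add: covers_def structural_rules_def fset_of_list_map ctx_list_props)
next
  case (weaken \<Gamma> c a)
  then show ?thesis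
    by (intro enumerated_rule_structural[of "ctx_list \<Gamma>" a c 0])
      (simp add: covers_def structural_rules_def fset_of_list_map ctx_list_props)
next
  case (cut \<Gamma> a c)
  then show ?thesis
    by (intro enumerated_rule_structural[of "ctx_list \<Gamma>" a c 0])
      (simp add: covers_def structural_rules_def fset_of_list_map ctx_list_props)
next
  case (substitution \<Gamma> c s v)
  then show ?thesis
    by (intro enumerated_rule_structural[of "ctx_list \<Gamma>" s c v])
      (simp add: covers_def structural_rules_def fset_of_list_map ctx_list_props)
next
  case (true_intro \<Gamma> a)
  then show ?thesis
    by (intro enumerated_rule_logical[of "ctx_list \<Gamma>" a "ZERO" "ZERO"])
      (simp add: covers_def logical_rules_def)
next
  case (true_elim \<Gamma> a)
  then show ?thesis
    by (intro enumerated_rule_logical[of "ctx_list \<Gamma>" a "ZERO" "ZERO"])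
      (simp add: covers_def logical_rules_def)
next
  case (false_intro \<Gamma> a)
  then show ?thesis
    by (intro enumerated_rule_logical[of "ctx_list \<Gamma>" a "ZERO" "ZERO"])
      (simp add: covers_def logical_rules_def)
next
  case (false_elim \<Gamma> a)
  then show ?thesis
    by (intro enumerated_rule_logical[of "ctx_list \<Gamma>" a "ZERO" "ZERO"])
      (simp add: covers_def logical_rules_def)
next
  case (explosion c \<Gamma> a)
  then show ?thesis
    by (intro enumerated_rule_logical[of "ctx_list \<Gamma>" a "ZERO" c])
      (simp add: covers_def logical_rules_def)
next
  case (dneg_intro \<Gamma> a)
  then show ?thesis
    by (intro enumerated_rule_logical[of "ctx_list \<Gamma>" a "ZERO" "ZERO"])
      (simp add: covers_def logical_rules_def)
next
  case (dneg_elim \<Gamma> a)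
  then show ?thesis
    by (intro enumerated_rule_logical[of "ctx_list \<Gamma>" a "ZERO" "ZERO"])
      (simp add: covers_def logical_rules_def)
next
  case (or_intro1 b \<Gamma> a)
  then show ?thesis
    by (intro enumerated_rule_logical[of "ctx_list \<Gamma>" a b "ZERO"])
      (simp add: covers_def logical_rules_def)
next
  case (or_intro2 a \<Gamma> b)
  then show ?thesis
    by (intro enumerated_rule_logical[of "ctx_list \<Gamma>" a b "ZERO"])
      (simp add: covers_def logical_rules_def)
next
  case (nor_intro \<Gamma> a b)
  then show ?thesis
    by (intro enumerated_rule_logical[of "ctx_list \<Gamma>" a b "ZERO"])
      (simp add: covers_def logical_rules_def)
next
  case (or_elim \<Gamma> a b c)
  then show ?thesis
    by (intro enumerated_rule_logical[of "ctx_list \<Gamma>" a b c])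
      (simp add: covers_def logical_rules_def)
next
  case (nor_elim1 \<Gamma> a b)
  then show ?thesis
    by (intro enumerated_rule_logical[of "ctx_list \<Gamma>" a b "ZERO"])
      (simp add: covers_def logical_rules_def)
next
  case (nor_elim2 \<Gamma> a b)
  then show ?thesis
    by (intro enumerated_rule_logical[of "ctx_list \<Gamma>" a b "ZERO"])
      (simp add: covers_def logical_rules_def)
next
  case (nat_eq \<Gamma> a)
  then show ?thesis
    by (intro enumerated_rule_equality[of "ctx_list \<Gamma>" a "ZERO" "ZERO" 0])
      (simp add: covers_def equality_rules_def)
next
  case (eq_nat \<Gamma> a)
  then show ?thesis
    by (intro enumerated_rule_equality[of "ctx_list \<Gamma>" a "ZERO" "ZERO" 0])
      (simp add: covers_def equality_rules_def)
next
  case (eq_sym \<Gamma> a b)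
  then show ?thesis
    by (intro enumerated_rule_equality[of "ctx_list \<Gamma>" a b "ZERO" 0])
      (simp add: covers_def equality_rules_def)
next
  case (eq_subst p \<Gamma> a b v)
  then show ?thesis
    by (intro enumerated_rule_equality[of "ctx_list \<Gamma>" a b p v])
      (simp add: covers_def equality_rules_def)
next
  case (neq_sym \<Gamma> a b)
  then show ?thesis
    by (intro enumerated_rule_equality[of "ctx_list \<Gamma>" a b "ZERO" 0])
      (simp add: covers_def equality_rules_def)
next
  case (eq_bool \<Gamma> a b)
  then show ?thesis
    by (intro enumerated_rule_equality[of "ctx_list \<Gamma>" a b "ZERO" 0])
      (simp add: covers_def equality_rules_def)
next
  case (eq_bool_elim \<Gamma> a b)
  then show ?thesis
    by (intro enumerated_rule_equality[of "ctx_list \<Gamma>" a b "ZERO" 0])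
      (simp add: covers_def equality_rules_def)
next
  case (zero_nat \<Gamma>)
  then show ?thesis
    by (intro enumerated_rule_nat[of "ctx_list \<Gamma>" "ZERO" "ZERO" "ZERO" 0])
      (simp add: covers_def nat_rules_def ctx_list_props)
next
  case (suc_nat \<Gamma> a)
  then show ?thesis
    by (intro enumerated_rule_nat[of "ctx_list \<Gamma>" a "ZERO" "ZERO" 0])
      (simp add: covers_def nat_rules_def ctx_list_props)
next
  case (suc_nat_elim \<Gamma> a)
  then show ?thesis
    by (intro enumerated_rule_nat[of "ctx_list \<Gamma>" a "ZERO" "ZERO" 0])
      (simp add: covers_def nat_rules_def ctx_list_props)
next
  case (suc_neq_zero \<Gamma> a)
  then show ?thesis
    by (intro enumerated_rule_nat[of "ctx_list \<Gamma>" a "ZERO" "ZERO" 0])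
      (simp add: covers_def nat_rules_def ctx_list_props)
next
  case (suc_neq \<Gamma> a b)
  then show ?thesis
    by (intro enumerated_rule_nat[of "ctx_list \<Gamma>" a b "ZERO" 0])
      (simp add: covers_def nat_rules_def ctx_list_props)
next
  case (suc_neq_elim \<Gamma> a b)
  then show ?thesis
    by (intro enumerated_rule_nat[of "ctx_list \<Gamma>" a b "ZERO" 0])
      (simp add: covers_def nat_rules_def ctx_list_props)
next
  case (suc_inj \<Gamma> a b)
  then show ?thesis
    by (intro enumerated_rule_nat[of "ctx_list \<Gamma>" a b "ZERO" 0])
      (simp add: covers_def nat_rules_def ctx_list_props)
next
  case (bot_nat p \<Gamma>)
  then show ?thesis
    by (intro enumerated_rule_nat[of "ctx_list \<Gamma>" "ZERO" "ZERO" p 0])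
      (simp add: covers_def nat_rules_def ctx_list_props)
next
  case (nat_induction c i \<Gamma> a)
  then show ?thesis
    by (intro enumerated_rule_nat[of "ctx_list \<Gamma>" a "ZERO" c i])
      (simp add: covers_def nat_rules_def ctx_list_props)
next
  case (recursor g \<Gamma> m h)
  then show ?thesis
    by (intro enumerated_rule_nat[of "ctx_list \<Gamma>" g h m 0])
      (simp add: covers_def nat_rules_def ctx_list_props)
next
  case (all_intro \<Gamma> f)
  then show ?thesis
    by (intro enumerated_rule_quantifier[of "ctx_list \<Gamma>" "ZERO" f])
      (simp add: covers_def quantifier_rules_def fset_of_list_map)
next
  case (all_elim \<Gamma> f a)
  then show ?thesis
    by (intro enumerated_rule_quantifier[of "ctx_list \<Gamma>" a f])
      (simp add: covers_def quantifier_rules_def fset_of_list_map)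
next
  case (nall_intro \<Gamma> f a)
  then show ?thesis
    by (intro enumerated_rule_quantifier[of "ctx_list \<Gamma>" a f])
      (simp add: covers_def quantifier_rules_def fset_of_list_map)
next
  case (nall_elim \<Gamma> f c)
  then show ?thesis
    by (intro enumerated_rule_quantifier[of "ctx_list \<Gamma>" f c])
      (simp add: covers_def quantifier_rules_def fset_of_list_map)
next
  case (conv_expand c c' \<Gamma>)
  from \<open>c \<triangleright> c'\<close> obtain us a b v w where "w"
    and sub: "set (conversions (ctx_list \<Gamma>) w c c') \<subseteq> set (conversion_rules (ctx_list \<Gamma>) us a b v)"
    by (rule head_step_conversions)
  then have "covers (conversion_rules (ctx_list \<Gamma>) us a b v) Js J"
    using conv_expand by (intro covers_mono[OF _ sub]) (simp add: covers_def conversions_def)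
  then show ?thesis by (rule enumerated_rule_conversion)
next
  case (conv_reduce c c' \<Gamma>)
  from \<open>c \<triangleright> c'\<close> obtain us a b v w where "w"
    and sub: "set (conversions (ctx_list \<Gamma>) w c c') \<subseteq> set (conversion_rules (ctx_list \<Gamma>) us a b v)"
    by (rule head_step_conversions)
  then have "covers (conversion_rules (ctx_list \<Gamma>) us a b v) Js J"
    using conv_reduce by (intro covers_mono[OF _ sub]) (simp add: covers_def conversions_def)
  then show ?thesis by (rule enumerated_rule_conversion)
next
  case (conv_eq c c' \<Gamma>)
  from \<open>c \<triangleright> c'\<close> obtain us a b v w where "w"
    and sub: "set (conversions (ctx_list \<Gamma>) w c c') \<subseteq> set (conversion_rules (ctx_list \<Gamma>) us a b v)"
    by (rule head_step_conversions)
  then have "covers (conversion_rules (ctx_list \<Gamma>) us a b v) Js J"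
    using conv_eq by (intro covers_mono[OF _ sub]) (simp add: covers_def conversions_def)
  then show ?thesis by (rule enumerated_rule_conversion)

qed

section \<open>Enumerating the derivable sequents\<close>

definition known :: "jdg list \<Rightarrow> jdg \<Rightarrow> bool" where
  "known T P \<longleftrightarrow> list_ex (\<lambda>J. snd J = snd P \<and>
     list_all (\<lambda>x. list_ex (\<lambda>y. y = x) (fst P)) (fst J) \<and>
     list_all (\<lambda>x. list_ex (\<lambda>y. y = x) (fst J)) (fst P)) T"

lemma fset_of_list_eq_iff: "fset_of_list G = fset_of_list H \<longleftrightarrow> set G = set H"
  by (metis fset_inject fset_of_list.rep_eq)

lemma known_iff: "known T P \<longleftrightarrow> seq P \<in> seq ` set T"
proof -
  have "seq P = seq J \<longleftrightarrow> snd J = snd P \<and> set (fst J) \<subseteq> set (fst P) \<and> set (fst P) \<subseteq> set (fst J)" for J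
    by (cases P; cases J) (auto simp: fset_of_list_eq_iff)
  then show ?thesis
    by (auto simp: known_def list_ex_iff list_all_iff image_iff subset_iff)
qed

lemma computable_known [computable_intros]:
  "computable T \<Longrightarrow> computable P \<Longrightarrow> computable (\<lambda>p. known (T p) (P p))"
proof (rule computable_binary[of known])
  show "computable known" by (rule computable_curry, unfold known_def) (intro computable_intros)
qed

text \<open>
  The parameters of a rule instance are read off from a list of terms, because lists of terms can be
  enumerated: the context and the list of further arguments are packed as the arguments of an operator node, and
  the number as a variable. Missing entries are read as some default.
\<close>

definition args :: "tm \<Rightarrow> tm list" where
  "args t = case_tm (\<lambda>_. []) (\<lambda>_ _ ts. ts) t"

definition idx :: "tm \<Rightarrow> nat" where
  "idx t = case_tm (\<lambda>i. i) (\<lambda>_ _ _. 0) t"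

primrec nth_arg :: "nat \<Rightarrow> tm list \<Rightarrow> tm" where
  "nth_arg 0 l = case_list (Var 0) (\<lambda>x _. x) l"
| "nth_arg (Suc n) l = nth_arg n (case_list [] (\<lambda>_ xs. xs) l)"

lemma computable_nth_arg [computable_intros]:
  "computable l \<Longrightarrow> computable (\<lambda>p. nth_arg n (l p))"
proof (induction n arbitrary: l)
  case 0
  then show ?case unfolding nth_arg.simps by (intro computable_intros)
next
  case (Suc n)
  show ?case unfolding nth_arg.simps by (intro Suc computable_intros)
qed

lemma computable_args [computable_intros]:
  "computable t \<Longrightarrow> computable (\<lambda>p. args (t p))"
  unfolding args_def by (intro computable_intros)

lemma computable_idx [computable_intros]:
  "computable t \<Longrightarrow> computable (\<lambda>p. idx (t p))"
  unfolding idx_def by (intro computable_intros)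

lemma computable_apps [computable_intros]:
  "computable t \<Longrightarrow> computable l \<Longrightarrow> computable (\<lambda>p. apps (t p) (l p))"
  unfolding apps_def by (intro computable_intros)

definition coded_instances :: "tm list \<Rightarrow> rule_instance list" where
  "coded_instances p = rule_instances (args (nth_arg 0 p)) (args (nth_arg 1 p))
     (nth_arg 2 p) (nth_arg 3 p) (nth_arg 4 p) (idx (nth_arg 5 p))"

lemma computable_coded_instances [computable_intros]:
  "computable l \<Longrightarrow> computable (\<lambda>p. coded_instances (l p))"
proof (rule computable_unary[of coded_instances])
  have "computable (\<lambda>p. coded_instances p)"
    unfolding coded_instances_def rule_instances_def structural_rules_def logical_rules_def
      equality_rules_def nat_rules_def quantifier_rules_def conversion_rules_def conversions_def
    by (intro computable_intros)
  then show "computable coded_instances" .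
qed

lemma coded_instances_all: "\<exists>p. coded_instances p = rule_instances G us a b c v"
  by (rule exI[of _ "[Op OBot 0 G, Op OBot 0 us, a, b, c, Var v]"])
    (simp add: coded_instances_def args_def idx_def eval_nat_numeral)

text \<open>
  In each round, the rules are applied to the sequents known so far, with all parameters that were
  enumerated up to this round.
\<close>

definition theorems :: "nat \<Rightarrow> jdg list" where
  "theorems n = rec_nat [] (\<lambda>n T. T @ List.bind (tm_lists n) (\<lambda>p. List.bind (coded_instances p)
     (\<lambda>x. if fst x \<and> list_all (known T) (fst (snd x)) then [snd (snd x)] else []))) n"

lemma computable_theorems [computable_intros]:
  "computable n \<Longrightarrow> computable (\<lambda>p. theorems (n p))"
  unfolding theorems_def by (intro computable_intros)

lemma theorems_0 [simp]: "theorems 0 = []"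
  by (simp add: theorems_def)

lemma theorems_Suc: "set (theorems (Suc n)) = set (theorems n) \<union>
   {C. \<exists>p \<in> set (tm_lists n). \<exists>Ps. (True, Ps, C) \<in> set (coded_instances p) \<and>
     (\<forall>P \<in> set Ps. seq P \<in> seq ` set (theorems n))}"
proof -
  have "theorems (Suc n) = theorems n @ List.bind (tm_lists n) (\<lambda>p. List.bind (coded_instances p)
     (\<lambda>x. if fst x \<and> list_all (known (theorems n)) (fst (snd x)) then [snd (snd x)] else []))"
    by (simp add: theorems_def)
  then show ?thesis by (force simp: set_list_bind list_all_iff known_iff split: if_splits)
qed

lemma theorems_mono: "m \<le> n \<Longrightarrow> set (theorems m) \<subseteq> set (theorems n)"
  by (rule lift_Suc_mono_le[of "\<lambda>n. set (theorems n)"]) (auto simp: theorems_Suc)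

lemma seq_theorems_mono: "m \<le> n \<Longrightarrow> J \<in> seq ` set (theorems m) \<Longrightarrow> J \<in> seq ` set (theorems n)"
  using theorems_mono by blast

lemma theorems_sound: "J \<in> set (theorems n) \<Longrightarrow> derivable (seq J)"
proof (induction n arbitrary: J)
  case (Suc n)
  from Suc.prems consider "J \<in> set (theorems n)"
    | p Ps where "(True, Ps, J) \<in> set (coded_instances p)" "\<forall>P \<in> set Ps. seq P \<in> seq ` set (theorems n)"
    unfolding theorems_Suc by blast
  then show ?case
  proof cases
    case 2
    then show ?thesis using Suc.IH
      by (intro derivable_rule[OF rule_instances_sound]) (auto simp: coded_instances_def)
  qed (rule Suc.IH)
qed simp

lemma theorems_complete: "derivable J \<Longrightarrow> \<exists>n. J \<in> seq ` set (theorems n)"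
proof (induction rule: derivable_induct)
  case (rule Js J)
  have "\<exists>n. \<forall>J' \<in> set Js. J' \<in> seq ` set (theorems n)"
    using rule(2)
  proof (induction Js)
    case (Cons K Ks)
    then obtain m n where "K \<in> seq ` set (theorems m)" "\<forall>J' \<in> set Ks. J' \<in> seq ` set (theorems n)"
      by auto
    then have "\<forall>J' \<in> set (K # Ks). J' \<in> seq ` set (theorems (max m n))"
      using seq_theorems_mono[of m "max m n"] seq_theorems_mono[of n "max m n"] by simp
    then show ?case by blast
  qed simp
  then obtain n where n: "\<forall>J' \<in> set Js. J' \<in> seq ` set (theorems n)" by blast
  obtain G us a b c v Ps C where C: "(True, Ps, C) \<in> set (rule_instances G us a b c v)"
      "map seq Ps = Js" "seq C = J"
    using rule_instances_complete[OF rule(1)] unfolding enumerated_rule_def covers_def by fastforce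
  obtain p where p: "coded_instances p = rule_instances G us a b c v"
    using coded_instances_all by blast
  obtain m where m: "p \<in> set (tm_lists m)" using tm_lists_exhaustive by blast
  let ?N = "max m n"
  have "p \<in> set (tm_lists ?N)" using m tm_lists_mono[of m ?N] by auto
  moreover have "\<forall>P \<in> set Ps. seq P \<in> seq ` set (theorems ?N)"
    using n C(2) seq_theorems_mono[OF max.cobounded2] by fastforce
  ultimately have "C \<in> set (theorems (Suc ?N))" using C(1)[folded p] unfolding theorems_Suc by blast
  then show ?case using C(3) by blast
qed

section \<open>The diagonal term\<close>

text \<open>
  What the diagonal term denies for each \<open>n\<close>. The empty list is the only representation of the empty context.
\<close>

definition diag_derived :: "tm \<Rightarrow> nat \<Rightarrow> bool" where
  "diag_derived q n = list_ex (\<lambda>J. fst J = [] \<and> snd J = FORALL \<bullet> (q \<bullet> quote q)) (theorems n)"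

lemma diag_derived_iff: "(\<exists>n. diag_derived q n) \<longleftrightarrow> derivable ({||} \<turnstile> FORALL \<bullet> (q \<bullet> quote q))"
proof
  assume "\<exists>n. diag_derived q n"
  then show "derivable ({||} \<turnstile> FORALL \<bullet> (q \<bullet> quote q))"
    using theorems_sound by (fastforce simp: diag_derived_def list_ex_iff)
next
  assume "derivable ({||} \<turnstile> FORALL \<bullet> (q \<bullet> quote q))"
  then obtain n G where "(G, FORALL \<bullet> (q \<bullet> quote q)) \<in> set (theorems n)" "fset_of_list G = {||}"
    using theorems_complete by fastforce
  then show "\<exists>n. diag_derived q n"
    by (intro exI[of _ n]) (force simp: diag_derived_def list_ex_iff fset_of_list_eq_iff[of _ "[]", simplified])
qed

lemma computable_diag_derived: "computable diag_derived"
  by (rule computable_curry, unfold diag_derived_def) (intro computable_intros)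

text \<open>
  Recursion over a numeral with the represented zero and successor. The reduction of the recursor of
  RGA works directly on numerals.
\<close>

definition decode_tm :: tm where
  "decode_tm = REC \<bullet> nil_tm \<bullet> LAM (LAM (suc_tm \<bullet> Var 0))"

lemma closed_wf_num [simp]: "closed_wf (num n)"
  by (induction n) (auto intro!: closed_wf_I)

lemma closed_wf_decode_tm [simp]: "closed_wf decode_tm"
  by (auto simp: decode_tm_def intro!: closed_wf_I)

lemma rep_decode: "rep n (decode_tm \<bullet> num n)"
proof (induction n)
  case 0
  have "decode_tm \<bullet> num 0 \<triangleright>* nil_tm"
    unfolding decode_tm_def by (auto intro!: head_step.rec_zero simp: r_into_rtranclp)
  then show ?case using rep_0 by (rule rep_reds[rotated]) (auto simp: decode_tm_def intro!: closed_wf_I)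
next
  case (Suc n)
  let ?h = "LAM (LAM (suc_tm \<bullet> Var 0))"
  have "decode_tm \<bullet> num (Suc n) \<triangleright> ?h \<bullet> num n \<bullet> (decode_tm \<bullet> num n)"
    unfolding decode_tm_def num.simps by (rule head_step.rec_suc) simp
  also have "?h \<bullet> num n \<bullet> (decode_tm \<bullet> num n) \<triangleright>* suc_tm \<bullet> (decode_tm \<bullet> num n)"
    using reds_beta2[of "num n" "decode_tm \<bullet> num n" "suc_tm \<bullet> Var 0"] by simp
  finally show ?case
    by (rule rep_reds[rotated]) (use closed_wf_num[of "Suc n"] rep_app[OF rep_Suc Suc] in auto)
qed

lemma derivable_reds: "t \<triangleright>* t' \<Longrightarrow> derivable (\<Gamma> \<turnstile> t) \<longleftrightarrow> derivable (\<Gamma> \<turnstile> t')"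
proof (induction rule: rtranclp_induct)
  case (step t' t'')
  have "derivable (\<Gamma> \<turnstile> t') \<longleftrightarrow> derivable (\<Gamma> \<turnstile> t'')"
  proof
    show "derivable (\<Gamma> \<turnstile> t'')" if "derivable (\<Gamma> \<turnstile> t')"
      using derivable_rule[OF conv_reduce[OF step(2)]] that by simp
    show "derivable (\<Gamma> \<turnstile> t')" if "derivable (\<Gamma> \<turnstile> t'')"
      using derivable_rule[OF conv_expand[OF step(2)]] that by simp
  qed
  then show ?case using step by simp
qed simp

lemma derivable_isN_num: "derivable (\<Gamma> \<turnstile> isN (num n))"
  by (induction n) (auto intro: derivable_rule[OF zero_nat] derivable_rule[OF suc_nat])

theorem theorem6p1:
  "\<exists>u. closed_tm u \<and> wf_tm u \<and>
       (\<forall>n. derivable ({||} \<turnstile> u \<bullet> num n)) \<and>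
       \<not> derivable ({||} \<turnstile> FORALL \<bullet> u)"
proof -
  obtain D where D: "rep diag_derived D" using computable_diag_derived by (auto simp: computable_def)
  let ?true = "isN ZERO" and ?false = "ZERO \<^bold>= SUC ZERO"
  \<comment> \<open>\<open>D\<close> selects between two formulas according to its answer.\<close>
  define q where "q = LAM (LAM (D \<bullet> Var 1 \<bullet> (decode_tm \<bullet> Var 0) \<bullet> ?false \<bullet> ?true))"
  define u where "u = q \<bullet> quote q"
  have cw: "closed_wf D" "closed_wf (quote q)" "closed_wf ?true" "closed_wf ?false"
    using rep_closed_wf[OF D] rep_closed_wf[OF rep_quote] by (auto intro!: closed_wf_I)
  then have "closed_wf q" by (auto simp: q_def intro!: closed_wf_I)
  have red: "u \<bullet> num n \<triangleright>* (if diag_derived q n then ?false else ?true)" for n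
  proof -
    have "u \<bullet> num n \<triangleright>* D \<bullet> quote q \<bullet> (decode_tm \<bullet> num n) \<bullet> ?false \<bullet> ?true"
      using reds_beta2[of "quote q" "num n" "D \<bullet> Var 1 \<bullet> (decode_tm \<bullet> Var 0) \<bullet> ?false \<bullet> ?true"] cw
      by (simp add: u_def q_def[simplified, symmetric])
    moreover have "D \<bullet> quote q \<bullet> (decode_tm \<bullet> num n) \<bullet> ?false \<bullet> ?true \<triangleright>* (if diag_derived q n then ?false else ?true)"
      using rep_app[OF rep_app[OF D rep_quote] rep_decode] cw by (simp add: rep_bool_def)
    ultimately show ?thesis by (rule rtranclp_trans)
  qed
  have "\<not> diag_derived q n" for n
  proof
    assume n: "diag_derived q n"
    then have "derivable ({||} \<turnstile> FORALL \<bullet> u)" using diag_derived_iff u_def by blast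
    then have "derivable ({||} \<turnstile> u \<bullet> num n)"
      using derivable_isN_num by (intro derivable_rule[OF all_elim]) auto
    then show False using derivable_reds[OF red[of n], of "{||}"] n consistent by simp
  qed
  then have "derivable ({||} \<turnstile> u \<bullet> num n)" for n
    using derivable_reds[OF red[of n], of "{||}"] derivable_rule[OF zero_nat, of "{||}"] by simp
  moreover have "\<not> derivable ({||} \<turnstile> FORALL \<bullet> u)"
    using \<open>\<And>n. \<not> diag_derived q n\<close> diag_derived_iff u_def by blast
  moreover have "closed_wf u" using \<open>closed_wf q\<close> cw by (simp add: u_def)
  then have "closed_tm u" "wf_tm u" by simp_all
  ultimately show ?thesis by blast
qed

end
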